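(* Let $q \geq 2$ be an integer and let $f \colon \mathbb{N}_0 \to \mathbb{U}$ be a $q$-semimultiplicative sequence. Then at least one of the following holds: (1) $f$ is almost periodic; (2) there exists $P$ such that for every pair of distinct primes $p, p' \geq P$, \[ \frac{1}{N}\sum_{n=0}^{N-1} f(pn)\overline{f(p'n)} \to 0 \quad \text{as } N \to \infty. \]
   Context: $\mathbb{U} = \{z \in \mathbb{C} : |z| = 1\}$, $\mathbb{N}_0 = \{0,1,2,\dots\}$, $[N] = \{0,1,\dots,N-1\}$. A sequence $f \colon \mathbb{N}_0 \to \mathbb{U}$ is $q$-semimultiplicative if $f(0) = 1$ and there exists $r \geq 0$ such that $f(n+m+k) = f(n+m)\,f(m+k)/f(m)$ for all integers $n,m,k \geq 0$ for which there is some $l \geq 0$ with $k < q^l$, $q^l \mid m$, $m < q^{l+r}$ and $q^{l+r} \mid n$. For a finite set $A$, a condition holds for $\varepsilon$-almost every $x \in A$ if it holds for all $x$ in some $A' \subset A$ with $|A \setminus A'| \leq \varepsilon |A|$. A bounded sequence $f \colon \mathbb{N}_0 \to \mathbb{C}$ is almost periodic if for every $\varepsilon > 0$ there exists $Q > 0$ such that for every $N \geq 0$ there is a sequence $g \colon [N] \to \mathbb{C}$ with period $Q$ (the choice of $g$ may depend on $N$) such that $|f(n) - g(n)| \leq \varepsilon$ for $\varepsilon$-almost all $n \in [N]$. *)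

theory Defs
  imports "HOL-Analysis.Analysis" "HOL-Computational_Algebra.Primes"
begin

definition q_semimultiplicative :: "nat \<Rightarrow> (nat \<Rightarrow> complex) \<Rightarrow> bool" where
  "q_semimultiplicative q f \<longleftrightarrow>
     range f \<subseteq> sphere 0 1 \<and> f 0 = 1 \<and>
     (\<exists>r. \<forall>n m k.
        (\<exists>l. k < q ^ l \<and> q ^ l dvd m \<and> m < q ^ (l + r) \<and> q ^ (l + r) dvd n) \<longrightarrow>
        f (n + m + k) = f (n + m) * f (m + k) / f m)"

definition eps_almost_every :: "real \<Rightarrow> 'a set \<Rightarrow> ('a \<Rightarrow> bool) \<Rightarrow> bool" where
  "eps_almost_every \<epsilon> A P \<longleftrightarrow>
     finite A \<and>
     (\<exists>A'\<subseteq>A. real (card (A - A')) \<le> \<epsilon> * real (card A) \<and> (\<forall>x\<in>A'. P x))"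

(* A sequence on [N] is a function on nat of which only the values below N matter,
   so periodicity is required only when both arguments lie in [N]. *)
definition has_period_below :: "nat \<Rightarrow> nat \<Rightarrow> (nat \<Rightarrow> 'a) \<Rightarrow> bool" where
  "has_period_below N Q g \<longleftrightarrow> (\<forall>n. n + Q < N \<longrightarrow> g (n + Q) = g n)"

definition almost_periodic :: "(nat \<Rightarrow> complex) \<Rightarrow> bool" where
  "almost_periodic f \<longleftrightarrow>
     bounded (range f) \<and>
     (\<forall>\<epsilon>>0. \<exists>Q>0. \<forall>N. \<exists>g. has_period_below N Q g \<and>
        eps_almost_every \<epsilon> {..<N} (\<lambda>n. cmod (f n - g n) \<le> \<epsilon>))"

end

theory Submission
  imports Defs "HOL-Number_Theory.Cong"
begin

text \<open>
  Grouping digits, assume that \<open>f (n + m + k)\<close> splits as soon as \<open>n\<close> and \<open>k\<close> are separated by one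
  base-\<open>q\<close> digit \<open>m\<close>. Let \<open>a l\<close> be the largest modulus of an average of \<open>f (p n) * cnj (f (p' n))\<close>
  over a block of length \<open>q\<^sup>l\<close>, with arbitrary digits added above. An average at level
  \<open>l + T\<close> is a mean of \<open>q\<^sup>T\<close> averages at level \<open>l\<close>, so \<open>a\<close> decreases. If its limit is positive, then at a
  near-maximum all these averages almost agree, with errors that are square-summable in \<open>l\<close>.
  Comparing averages with equal carries shows that the shift ratios
  \<open>f\<^sub>l (y + p q) / f\<^sub>l y\<close> and \<open>f\<^sub>l (y' + p' q) / f\<^sub>l y'\<close> of \<open>f\<^sub>l n = f (q\<^sup>l n)\<close> almost agree whenever
  \<open>p' y - p y'\<close> is congruent to some \<open>s\<close> with \<open>- p' < s < p\<close> modulo a high power of \<open>q\<close>. Choosing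
  \<open>s\<close> among \<open>0\<close>, \<open>- p\<close>, \<open>1 - p'\<close> and \<open>1\<close>, these ratios are almost constant. By Bezout
  \<open>f\<^sub>l n\<close> is then close to \<open>\<zeta>\<^sub>l\<^sup>n\<close> for small \<open>n\<close>, where \<open>\<zeta>\<^sub>l\<close> is a root of unity of order dividing
  \<open>p' - p\<close>, and for large \<open>l\<close> the root at level \<open>l + 1\<close> is the \<open>q\<close>-th power of \<open>\<zeta>\<^sub>l\<close>. Changing one digit of \<open>n\<close> moves
  \<open>f\<^sub>L n / \<zeta>\<^sub>L\<^sup>n\<close> only a little, so its variance over \<open>n < q\<^sup>K\<close> is a small tail of a convergent series
  and \<open>f\<close> is almost periodic.
\<close>

section \<open>Means over blocks of digits\<close>

text \<open>The variance identity. It serves twice: for means over digits of one sequence and for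
  correlation averages near their supremum.\<close>

lemma sum_norm_diff_mean:
  fixes z :: "nat \<Rightarrow> 'a::real_inner"
  assumes "(\<Sum>i<m. z i) = real m *\<^sub>R \<mu>"
  shows "(\<Sum>i<m. (norm (z i - \<mu>))\<^sup>2) = (\<Sum>i<m. (norm (z i))\<^sup>2) - real m * (norm \<mu>)\<^sup>2"
proof -
  have "(\<Sum>i<m. (norm (z i - \<mu>))\<^sup>2) = (\<Sum>i<m. (norm (z i))\<^sup>2 - 2 * (z i \<bullet> \<mu>) + (norm \<mu>)\<^sup>2)"
    by (simp add: power2_norm_eq_inner inner_diff_left inner_diff_right inner_commute algebra_simps)
  also have "\<dots> = (\<Sum>i<m. (norm (z i))\<^sup>2) - 2 * ((\<Sum>i<m. z i) \<bullet> \<mu>) + real m * (norm \<mu>)\<^sup>2"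
    by (simp add: sum.distrib sum_subtractf inner_sum_left sum_distrib_left)
  also have "\<dots> = (\<Sum>i<m. (norm (z i))\<^sup>2) - real m * (norm \<mu>)\<^sup>2"
    using assms by (simp add: power2_norm_eq_inner)
  finally show ?thesis .
qed

lemma unimodular_mult_cnj: "cmod z = 1 \<Longrightarrow> z * cnj z = 1"
  using complex_norm_square[of z] by simp

lemma sum_lessThan_mult:
  fixes g :: "nat \<Rightarrow> 'a::comm_monoid_add"
  shows "(\<Sum>n<a * b. g n) = (\<Sum>x<a. \<Sum>k<b. g (b * x + k))"
proof -
  have "(\<Sum>n<a * b. g n) = (\<Sum>x<a. sum g {x * b..<x * b + b})"
    by (rule sum.nat_group[symmetric])
  also have "\<dots> = (\<Sum>x<a. \<Sum>k<b. g (b * x + k))"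
  proof (rule sum.cong[OF refl])
    fix x
    have "sum g {x * b..<x * b + b} = sum g {0 + x * b..<b + x * b}"
      by (simp add: add.commute)
    also have "\<dots> = (\<Sum>k<b. g (b * x + k))"
      unfolding sum.shift_bounds_nat_ivl by (simp add: atLeast0LessThan algebra_simps)
    finally show "sum g {x * b..<x * b + b} = (\<Sum>k<b. g (b * x + k))" .
  qed
  finally show ?thesis .
qed

lemma norm_mean_le:
  fixes g :: "nat \<Rightarrow> complex"
  assumes "\<And>k. k < n \<Longrightarrow> cmod (g k) \<le> K" and "n > 0"
  shows "cmod ((\<Sum>k<n. g k) / of_nat n) \<le> K"
proof -
  have "cmod (\<Sum>k<n. g k) \<le> of_nat (card {..<n}) * K"
    by (rule sum_norm_bound) (use assms in auto)
  then show ?thesis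
    using assms(2) by (simp add: norm_divide pos_divide_le_eq mult.commute)
qed

lemma block_mean_step:
  fixes g :: "nat \<Rightarrow> complex" and q :: nat
  assumes "q > 0"
  shows "(\<Sum>k<q ^ Suc K. g (q ^ Suc K * x + k)) / of_nat (q ^ Suc K) =
    (\<Sum>d<q. (\<Sum>k<q ^ K. g (q ^ K * (q * x + d) + k)) / of_nat (q ^ K)) / of_nat q"
proof -
  have "(\<Sum>k<q ^ Suc K. g (q ^ Suc K * x + k)) =
      (\<Sum>d<q. \<Sum>k<q ^ K. g (q ^ Suc K * x + (q ^ K * d + k)))"
    unfolding power_Suc by (rule sum_lessThan_mult)
  also have "\<dots> = (\<Sum>d<q. \<Sum>k<q ^ K. g (q ^ K * (q * x + d) + k))"
    by (simp add: algebra_simps)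
  finally show ?thesis
    by (simp add: sum_divide_distrib mult.commute)
qed

text \<open>A block mean at level \<open>Suc K\<close> is the mean of \<open>q\<close> block means
  at level \<open>K\<close> that differ pairwise by at most \<open>\<beta> K\<close>. By the
  variance identity, averaging them costs at most \<open>(\<beta> K)\<^sup>2\<close> in squared
  modulus, so the losses add up as squares and not as first powers.\<close>

lemma norm_block_mean_ge:
  fixes R :: "nat \<Rightarrow> complex" and \<beta> :: "nat \<Rightarrow> real" and q :: nat
  assumes q: "q > 0" and R: "\<And>n. cmod (R n) = 1"
    and diff: "\<And>J x d d' k. d < q \<Longrightarrow> d' < q \<Longrightarrow> k < q ^ J \<Longrightarrow>
      cmod (R (q ^ J * (q * x + d) + k) - R (q ^ J * (q * x + d') + k)) \<le> \<beta> J"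
  shows "1 - (\<Sum>J<K. (\<beta> J)\<^sup>2) \<le> (cmod ((\<Sum>k<q ^ K. R (q ^ K * x + k)) / of_nat (q ^ K)))\<^sup>2"
proof (induction K arbitrary: x)
  case 0
  show ?case by (simp add: R)
next
  case (Suc K)
  define S where "S x = (\<Sum>k<q ^ K. R (q ^ K * x + k)) / of_nat (q ^ K)" for x
  define \<mu> where "\<mu> = (\<Sum>d<q. S (q * x + d)) / of_nat q"
  have S_diff: "cmod (S (q * x + d) - S (q * x + d')) \<le> \<beta> K" if "d < q" "d' < q" for d d'
  proof -
    have "cmod (\<Sum>k<q ^ K. R (q ^ K * (q * x + d) + k) - R (q ^ K * (q * x + d') + k))
        \<le> of_nat (card {..<q ^ K}) * \<beta> K"
      by (rule sum_norm_bound) (use diff that in auto)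
    then show ?thesis
      using q by (simp add: S_def sum_subtractf diff_divide_distrib[symmetric] norm_divide
          norm_power field_simps)
  qed
  have dev: "(cmod (S (q * x + d) - \<mu>))\<^sup>2 \<le> (\<beta> K)\<^sup>2" if "d < q" for d
  proof -
    have "cmod (\<Sum>d'<q. S (q * x + d) - S (q * x + d')) \<le> of_nat (card {..<q}) * \<beta> K"
      by (rule sum_norm_bound) (use S_diff that in auto)
    moreover have "S (q * x + d) - \<mu> = (\<Sum>d'<q. S (q * x + d) - S (q * x + d')) / of_nat q"
      using q by (simp add: \<mu>_def sum_subtractf field_simps)
    ultimately have "cmod (S (q * x + d) - \<mu>) \<le> \<beta> K"
      using q by (simp add: norm_divide pos_divide_le_eq mult.commute del: sum_subtractf)
    then show ?thesis by (simp add: power_mono)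
  qed
  have "(\<Sum>d<q. (cmod (S (q * x + d) - \<mu>))\<^sup>2) =
      (\<Sum>d<q. (cmod (S (q * x + d)))\<^sup>2) - real q * (cmod \<mu>)\<^sup>2"
    by (rule sum_norm_diff_mean) (use q in \<open>simp add: \<mu>_def scaleR_conv_of_real\<close>)
  moreover have "(\<Sum>d<q. (cmod (S (q * x + d) - \<mu>))\<^sup>2) \<le> real q * (\<beta> K)\<^sup>2"
    using sum_bounded_above[of "{..<q}" "\<lambda>d. (cmod (S (q * x + d) - \<mu>))\<^sup>2" "(\<beta> K)\<^sup>2"] dev by simp
  moreover have "real q * (1 - (\<Sum>J<K. (\<beta> J)\<^sup>2)) \<le> (\<Sum>d<q. (cmod (S (q * x + d)))\<^sup>2)"
    using sum_bounded_below[of "{..<q}" "1 - (\<Sum>J<K. (\<beta> J)\<^sup>2)" "\<lambda>d. (cmod (S (q * x + d)))\<^sup>2"]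
      Suc.IH by (simp add: S_def)
  ultimately have "real q * (1 - (\<Sum>J<K. (\<beta> J)\<^sup>2)) \<le> real q * ((cmod \<mu>)\<^sup>2 + (\<beta> K)\<^sup>2)"
    by (simp add: algebra_simps)
  then have "1 - (\<Sum>J<Suc K. (\<beta> J)\<^sup>2) \<le> (cmod \<mu>)\<^sup>2"
    using q by simp
  also have "\<mu> = (\<Sum>k<q ^ Suc K. R (q ^ Suc K * x + k)) / of_nat (q ^ Suc K)"
    unfolding \<mu>_def S_def by (rule block_mean_step[OF q, symmetric])
  finally show ?case .
qed

text \<open>For unimodular values the variance is one minus the squared modulus of the mean.\<close>

lemma block_variance_le:
  fixes R :: "nat \<Rightarrow> complex" and \<beta> :: "nat \<Rightarrow> real" and q :: nat
  assumes q: "q > 0" and R: "\<And>n. cmod (R n) = 1"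
    and diff: "\<And>J x d d' k. d < q \<Longrightarrow> d' < q \<Longrightarrow> k < q ^ J \<Longrightarrow>
      cmod (R (q ^ J * (q * x + d) + k) - R (q ^ J * (q * x + d') + k)) \<le> \<beta> J"
  shows "\<exists>\<mu>. (\<Sum>n<q ^ K. (cmod (R n - \<mu>))\<^sup>2) \<le> real (q ^ K) * (\<Sum>J<K. (\<beta> J)\<^sup>2)"
proof -
  define \<mu> where "\<mu> = (\<Sum>k<q ^ K. R k) / of_nat (q ^ K)"
  have "1 - (\<Sum>J<K. (\<beta> J)\<^sup>2) \<le> (cmod \<mu>)\<^sup>2"
    using norm_block_mean_ge[of q R \<beta> K 0] assms by (simp add: \<mu>_def)
  then have "real (q ^ K) * (1 - (cmod \<mu>)\<^sup>2) \<le> real (q ^ K) * (\<Sum>J<K. (\<beta> J)\<^sup>2)"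
    by (intro mult_left_mono) auto
  moreover have "(\<Sum>n<q ^ K. (cmod (R n - \<mu>))\<^sup>2) =
      (\<Sum>n<q ^ K. (cmod (R n))\<^sup>2) - real (q ^ K) * (cmod \<mu>)\<^sup>2"
    by (rule sum_norm_diff_mean) (use q in \<open>simp add: \<mu>_def scaleR_conv_of_real\<close>)
  ultimately show ?thesis
    by (auto simp: R algebra_simps intro!: exI[of _ \<mu>])
qed

section \<open>Sequences close to characters of bounded order\<close>

text \<open>The assumption \<open>cut\<close> is semimultiplicativity with \<open>r = 1\<close>:
  there \<open>m = q ^ l * (y mod q)\<close> is the separating digit and
  \<open>n + m = q ^ l * y\<close>.\<close>

locale semimultiplicative =
  fixes q :: nat and f :: "nat \<Rightarrow> complex"
  assumes q_ge_2: "q \<ge> 2"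
    and norm_f [simp]: "\<And>n. cmod (f n) = 1"
    and f_0 [simp]: "f 0 = 1"
    and cut: "\<And>k l y. k < q ^ l \<Longrightarrow>
      f (q ^ l * y + k) = f (q ^ l * y) * f (q ^ l * (y mod q) + k) / f (q ^ l * (y mod q))"
begin

lemma q_pos [simp]: "q > 0"
  using q_ge_2 by simp

lemma f_nonzero [simp]: "f n \<noteq> 0"
  by (metis norm_f norm_zero zero_neq_one)

text \<open>Allows a statement about the lowest digits to be used at every digit position.\<close>

lemma dilate: "semimultiplicative q (\<lambda>n. f (q ^ i * n))"
proof
  fix k l y assume "k < q ^ l"
  then have "q ^ i * k < q ^ (i + l)" by (simp add: power_add)
  from cut[OF this, of y]
  show "f (q ^ i * (q ^ l * y + k)) =
    f (q ^ i * (q ^ l * y)) * f (q ^ i * (q ^ l * (y mod q) + k)) / f (q ^ i * (q ^ l * (y mod q)))"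
    by (simp add: power_add algebra_simps)
qed (use q_ge_2 in auto)

end

lemma roots_of_unity_separated:
  fixes M :: nat
  assumes "M > 0"
  obtains \<delta> :: real where "\<delta> > 0"
    "\<And>x y::complex. x ^ M = 1 \<Longrightarrow> y ^ M = 1 \<Longrightarrow> cmod (x - y) < \<delta> \<Longrightarrow> x = y"
proof -
  define Z where "Z = {z::complex. z ^ M = 1}"
  have "finite Z" unfolding Z_def
    using assms by (intro finite_roots_unity) auto
  then obtain \<delta> :: real where "\<delta> > 0" "\<And>x y. x \<in> Z \<Longrightarrow> y \<in> Z \<Longrightarrow> x \<noteq> y \<Longrightarrow> \<delta> \<le> dist x y"
  proof -
    \<comment> \<open>The element \<open>1\<close> keeps the set nonempty when \<open>M = 1\<close>,
      so that its minimum makes sense.\<close>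
    define D where "D = insert 1 ((\<lambda>(x, y). dist x y) ` (Z \<times> Z - Id))"
    have "finite D" unfolding D_def using \<open>finite Z\<close> by simp
    moreover have "\<forall>t\<in>D. 0 < t" unfolding D_def by auto
    ultimately have "Min D > 0" "\<And>x y. x \<in> Z \<Longrightarrow> y \<in> Z \<Longrightarrow> x \<noteq> y \<Longrightarrow> Min D \<le> dist x y"
      by (auto simp: D_def intro!: Min_le)
    then show ?thesis using that by blast
  qed
  then show ?thesis
    using that[of \<delta>] unfolding Z_def by (force simp: dist_norm)
qed

context semimultiplicative begin

text \<open>The bound \<open>q ^ 3\<close> provides three consecutive digits: the one that is
  changed and its two neighbours, which separate it from all others.\<close>

lemma almost_periodic_if_close_to_characters:
  fixes M L0 :: nat and \<epsilon> :: "nat \<Rightarrow> real" and \<zeta> :: "nat \<Rightarrow> complex"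
  assumes M: "M > 0" and summable: "summable (\<lambda>l. (\<epsilon> l)\<^sup>2)"
    and root: "\<And>l. \<zeta> l ^ M = 1"
    and close: "\<And>l n. l \<ge> L0 \<Longrightarrow> n < q ^ 3 \<Longrightarrow> cmod (f (q ^ l * n) - \<zeta> l ^ n) \<le> \<epsilon> l"
  shows "almost_periodic f"
proof -
  have norm_\<zeta> [simp]: "cmod (\<zeta> l) = 1" for l
    using power_eq_1_iff[OF root[of l]] M by auto
  have q3: "q < q ^ 3" "1 < q ^ 3"
    using q_ge_2 power_strict_increasing[of 1 3 q] power_strict_increasing[of 0 3 q] by auto
  have \<epsilon>_tendsto: "\<epsilon> \<longlonglongrightarrow> 0"
    using tendsto_real_sqrt[OF summable_LIMSEQ_zero[OF summable]] by (simp add: tendsto_rabs_zero_iff)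
  obtain L1 where L1: "L1 \<ge> L0" and step: "\<And>l. l \<ge> L1 \<Longrightarrow> \<zeta> (Suc l) = \<zeta> l ^ q"
  proof -
    obtain \<delta> :: real where "\<delta> > 0"
      and \<delta>: "\<And>x y::complex. x ^ M = 1 \<Longrightarrow> y ^ M = 1 \<Longrightarrow> cmod (x - y) < \<delta> \<Longrightarrow> x = y"
      using roots_of_unity_separated[OF M] by blast
    from \<epsilon>_tendsto \<open>\<delta> > 0\<close> have "\<forall>\<^sub>F l in sequentially. \<epsilon> l < \<delta> / 2"
      by (intro order_tendstoD(2)) auto
    then obtain L2 where L2: "\<And>l. l \<ge> L2 \<Longrightarrow> \<epsilon> l < \<delta> / 2"
      by (auto simp: eventually_sequentially)
    show ?thesis
    proof (rule that[of "max L0 L2"])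
      fix l assume l: "max L0 L2 \<le> l"
      \<comment> \<open>The value \<open>f (q ^ Suc l)\<close> is near \<open>\<zeta> l ^ q\<close>
        (take \<open>n = q\<close> at level \<open>l\<close>) and near
        \<open>\<zeta> (Suc l)\<close> (take \<open>n = 1\<close> at the next level). Distinct roots
        of unity cannot be that close.\<close>
      have "cmod (f (q ^ l * q) - \<zeta> l ^ q) \<le> \<epsilon> l"
        using l q3 by (intro close) auto
      moreover have "cmod (f (q ^ Suc l * 1) - \<zeta> (Suc l) ^ 1) \<le> \<epsilon> (Suc l)"
        using l q3 by (intro close) auto
      ultimately have "cmod (f (q ^ l * q) - \<zeta> l ^ q - (f (q ^ l * q) - \<zeta> (Suc l))) \<le> \<epsilon> l + \<epsilon> (Suc l)"
        using norm_triangle_ineq4[of "f (q ^ l * q) - \<zeta> l ^ q" "f (q ^ l * q) - \<zeta> (Suc l)"]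
        by (simp add: mult.commute)
      also have "\<dots> < \<delta>"
        using L2[of l] L2[of "Suc l"] l by simp
      finally have "cmod (\<zeta> (Suc l) - \<zeta> l ^ q) < \<delta>" by simp
      moreover have "(\<zeta> l ^ q) ^ M = 1"
        by (metis root mult.commute power_mult power_one)
      ultimately show "\<zeta> (Suc l) = \<zeta> l ^ q"
        using \<delta> root by blast
    qed simp
  qed
  have \<zeta>_power: "\<zeta> (L + i) = \<zeta> L ^ (q ^ i)" if "L \<ge> L1" for L i
    using that by (induction i) (auto simp: step power_mult[symmetric] mult.commute)
  define R where "R L n = f (q ^ Suc L * n) * cnj (\<zeta> L ^ (q * n))" for L n
  have norm_R: "cmod (R L n) = 1" for L n
    by (simp add: R_def norm_mult norm_power)
  have R_diff: "cmod (R L (q ^ J * (q * x + d) + k) - R L (q ^ J * (q * x + d') + k)) \<le> 2 * \<epsilon> (L + J)"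
    if L: "L \<ge> L1" and d: "d < q" "d' < q" and k: "k < q ^ J" for L J x d d' k
  proof -
    \<comment> \<open>The digit \<open>d\<close> sits at position \<open>i + 1\<close>, between
      \<open>x mod q\<close> above and \<open>e\<close> below. The exponent \<open>Suc L\<close> in
      \<open>R\<close> ensures that there is a position \<open>i \<ge> L\<close> below it even when
      \<open>J = 0\<close>. Cutting at both neighbours puts all other digits into factors without
      \<open>d\<close>.\<close>
    define i where "i = L + J"
    define e where "e = q ^ Suc L * k div q ^ i"
    define m where "m = q ^ Suc L * k mod q ^ i"
    have "q ^ Suc L * k < q ^ i * q"
      using k by (simp add: i_def power_add)
    then have e: "e < q" unfolding e_def by (simp add: less_mult_imp_div_less mult.commute)
    have m: "m < q ^ i" unfolding m_def by simp
    have split_k: "q ^ Suc L * k = q ^ i * e + m" unfolding e_def m_def by simp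
    define U where "U = f (q ^ i * e + m) / f (q ^ i * e) *
      (f (q ^ (i + 2) * x) / f (q ^ (i + 2) * (x mod q)))"
    have norm_U: "cmod U = 1" unfolding U_def by (simp add: norm_mult norm_divide)
    define V where "V = cnj (\<zeta> L ^ (q * (q ^ Suc J * x + k)))"
    have norm_V: "cmod V = 1" unfolding V_def by (simp add: norm_power)
    define r where "r d = f (q ^ i * (q\<^sup>2 * (x mod q) + q * d + e)) * cnj (\<zeta> i ^ (q * d))" for d
    have R_eq: "R L (q ^ J * (q * x + d) + k) = U * V * r d" if "d < q" for d
    proof -
      have "q ^ Suc L * (q ^ J * (q * x + d) + k) = q ^ i * (q\<^sup>2 * x + q * d + e) + m"
        using split_k by (simp add: i_def power_add algebra_simps power2_eq_square)
      moreover have "f (q ^ i * (q\<^sup>2 * x + q * d + e) + m) =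
          f (q ^ i * (q\<^sup>2 * x + q * d + e)) * f (q ^ i * e + m) / f (q ^ i * e)"
        using cut[OF m, of "q\<^sup>2 * x + q * d + e"] e
        by (simp add: power2_eq_square mod_mult_self4 mult.assoc flip: distrib_left)
      moreover have "f (q ^ i * (q\<^sup>2 * x + q * d + e)) = f (q ^ (i + 2) * x) *
          f (q ^ i * (q\<^sup>2 * (x mod q) + q * d + e)) / f (q ^ (i + 2) * (x mod q))"
      proof -
        have "q * d + e < q\<^sup>2"
        proof -
          have "q * d + e < q * Suc d" using e by simp
          also have "\<dots> \<le> q * q" using \<open>d < q\<close> by (intro mult_le_mono2) simp
          finally show ?thesis by (simp add: power2_eq_square)
        qed
        then have "q ^ i * (q * d + e) < q ^ (i + 2)"
          by (simp add: power_add power2_eq_square del: distrib_left_numeral)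
        from cut[OF this, of x] show ?thesis
          by (simp add: power_add power2_eq_square algebra_simps)
      qed
      moreover have "\<zeta> L ^ (q * (q ^ J * (q * x + d) + k)) =
          \<zeta> L ^ (q * (q ^ Suc J * x + k)) * \<zeta> i ^ (q * d)"
        using \<zeta>_power[OF L, of J]
        by (simp add: i_def power_mult[symmetric] power_add[symmetric] algebra_simps)
      ultimately show ?thesis
        by (simp add: R_def U_def V_def r_def mult_ac)
    qed
    \<comment> \<open>The twist in \<open>r\<close> cancels the share of \<open>d\<close> in the
      character, so the same target serves for all \<open>d\<close>.\<close>
    have r_close: "cmod (r d - \<zeta> i ^ (q\<^sup>2 * (x mod q) + e)) \<le> \<epsilon> i" if "d < q" for d
    proof -
      define n where "n = q\<^sup>2 * (x mod q) + q * d + e"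
      have "q * d + e < q * Suc d" using e by simp
      also have "\<dots> \<le> q * q" using \<open>d < q\<close> by (intro mult_le_mono2) simp
      finally have "n < q\<^sup>2 * Suc (x mod q)" unfolding n_def by (simp add: power2_eq_square)
      also have "\<dots> \<le> q\<^sup>2 * q" by (intro mult_le_mono2) (simp add: Suc_leI)
      finally have "n < q ^ 3" by (simp add: power2_eq_square power3_eq_cube)
      then have "cmod (f (q ^ i * n) - \<zeta> i ^ n) \<le> \<epsilon> i"
        using L L1 by (intro close) (auto simp: i_def)
      moreover have "\<zeta> i ^ n * cnj (\<zeta> i ^ (q * d)) = \<zeta> i ^ (q\<^sup>2 * (x mod q) + e)"
      proof -
        have "\<zeta> i ^ n = \<zeta> i ^ (q\<^sup>2 * (x mod q) + e) * \<zeta> i ^ (q * d)"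
          by (simp add: n_def power_add)
        moreover have "\<zeta> i ^ (q * d) * cnj (\<zeta> i ^ (q * d)) = 1"
          by (rule unimodular_mult_cnj) (simp add: norm_power)
        ultimately show ?thesis by (simp add: mult.assoc)
      qed
      then have "r d - \<zeta> i ^ (q\<^sup>2 * (x mod q) + e) = (f (q ^ i * n) - \<zeta> i ^ n) * cnj (\<zeta> i ^ (q * d))"
        by (simp add: r_def n_def left_diff_distrib)
      ultimately show ?thesis
        by (simp add: norm_mult norm_power)
    qed
    have "cmod (R L (q ^ J * (q * x + d) + k) - R L (q ^ J * (q * x + d') + k)) = cmod (r d - r d')"
      using norm_U norm_V d by (simp add: R_eq norm_mult flip: right_diff_distrib)
    also have "\<dots> \<le> \<epsilon> i + \<epsilon> i"
      using norm_triangle_ineq4[of "r d - \<zeta> i ^ (q\<^sup>2 * (x mod q) + e)" "r d' - \<zeta> i ^ (q\<^sup>2 * (x mod q) + e)"]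
        r_close[OF d(1)] r_close[OF d(2)] by simp
    finally show ?thesis by (simp add: i_def)
  qed
  have main: "\<exists>Q>0. \<forall>N. \<exists>g. has_period_below N Q g \<and>
        eps_almost_every \<eta> {..<N} (\<lambda>n. cmod (f n - g n) \<le> \<eta>)" if "\<eta> > 0" for \<eta> :: real
  proof -
    \<comment> \<open>In the Chebyshev estimate below, \<open>4\<close> comes from squaring
      \<open>2 * \<epsilon>\<close>, \<open>q\<close> from enlarging \<open>N\<close> to
      \<open>B * q ^ K\<close>, and \<open>\<eta> ^ 3\<close> from the squared deviation times the
      allowed proportion of exceptions.\<close>
    define \<tau> where "\<tau> = \<eta> ^ 3 / (4 * real q)"
    have "\<tau> > 0" using that by (simp add: \<tau>_def)
    obtain L where L: "L \<ge> L1" and tail: "\<And>K. (\<Sum>J<K. (\<epsilon> (L + J))\<^sup>2) \<le> \<tau>"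
    proof -
      obtain L2 where L2: "\<And>n. n \<ge> L2 \<Longrightarrow> norm (\<Sum>i. (\<epsilon> (i + n))\<^sup>2) < \<tau>"
        using suminf_exist_split[OF \<open>\<tau> > 0\<close> summable] by blast
      show ?thesis
      proof (rule that[of "max L1 L2"])
        fix K
        have "(\<Sum>J<K. (\<epsilon> (J + max L1 L2))\<^sup>2) \<le> (\<Sum>J. (\<epsilon> (J + max L1 L2))\<^sup>2)"
          using summable by (intro sum_le_suminf) (auto simp: summable_iff_shift[of "\<lambda>l. (\<epsilon> l)\<^sup>2"])
        also have "\<dots> \<le> \<tau>" using L2[of "max L1 L2"] by simp
        finally show "(\<Sum>J<K. (\<epsilon> (max L1 L2 + J))\<^sup>2) \<le> \<tau>" by (simp add: add.commute)
      qed simp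
    qed
    define B where "B = q ^ Suc L"
    have "B > 0" by (simp add: B_def)
    \<comment> \<open>Multiples of \<open>B * q\<close> fix the low digits and the separating digit
      above them; the factor \<open>M\<close> makes the power of \<open>\<zeta> L\<close> periodic
      as well.\<close>
    define Q where "Q = B * q * M"
    have "Q > 0" using M by (simp add: Q_def B_def)
    have "\<exists>g. has_period_below N Q g \<and> eps_almost_every \<eta> {..<N} (\<lambda>n. cmod (f n - g n) \<le> \<eta>)" for N
    proof (cases "N < B")
      case True
      \<comment> \<open>The period exceeds \<open>N\<close>, so periodicity below \<open>N\<close>
        is vacuous and \<open>f\<close> approximates itself.\<close>
      have "B \<le> Q" using M by (simp add: Q_def Suc_leI)
      then have "has_period_below N Q f"
        using True by (simp add: has_period_below_def)
      moreover have "eps_almost_every \<eta> {..<N} (\<lambda>n. cmod (f n - f n) \<le> \<eta>)"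
        using \<open>\<eta> > 0\<close> by (auto simp: eps_almost_every_def intro!: exI[of _ "{..<N}"])
      ultimately show ?thesis by blast
    next
      case False
      obtain K where K: "N \<le> B * q ^ K" "B * q ^ K \<le> q * N"
      proof -
        define K where "K = (LEAST K. N \<le> B * q ^ K)"
        have "N < q ^ N" using q_ge_2 by (intro less_le_trans[OF less_exp] power_mono) auto
        also have "\<dots> \<le> B * q ^ N" using \<open>B > 0\<close> by simp
        finally have "N \<le> B * q ^ K"
          unfolding K_def by (rule LeastI[where P = "\<lambda>K. N \<le> B * q ^ K", OF less_imp_le])
        moreover have "B * q ^ K \<le> q * N"
        proof (cases K)
          case 0
          have "B \<le> 1 * N" using False by simp
          also have "\<dots> \<le> q * N" using q_ge_2 by (intro mult_le_mono1) simp
          finally show ?thesis using 0 by simp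
        next
          case (Suc K')
          then have "\<not> N \<le> B * q ^ K'"
            using not_less_Least[of K' "\<lambda>K. N \<le> B * q ^ K"] by (simp add: K_def)
          then have "q * (B * q ^ K') \<le> q * N" by (intro mult_le_mono2) simp
          then show ?thesis by (simp add: Suc algebra_simps)
        qed
        ultimately show ?thesis using that by blast
      qed
      obtain \<mu> where \<mu>: "(\<Sum>n<q ^ K. (cmod (R L n - \<mu>))\<^sup>2) \<le> real (q ^ K) * (\<Sum>J<K. (2 * \<epsilon> (L + J))\<^sup>2)"
        using block_variance_le[of q "R L" "\<lambda>J. 2 * \<epsilon> (L + J)" K] norm_R R_diff[OF L] by auto
      \<comment> \<open>\<open>H\<close> is the exact contribution of the digits below
        \<open>B\<close>. The approximant keeps it and the character, and replaces only
        \<open>R L\<close> by its mean.\<close>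
      define H where "H n = f (B * (n div B mod q) + n mod B) / f (B * (n div B mod q))" for n
      define g where "g n = H n * \<zeta> L ^ (q * (n div B)) * \<mu>" for n
      have "g (n + Q) = g n" for n
      proof -
        have "(n + Q) div B = n div B + q * M"
          using \<open>B > 0\<close> by (simp add: Q_def mult.assoc)
        moreover have "(n + Q) mod B = n mod B"
          by (simp add: Q_def mult.assoc)
        moreover have "\<zeta> L ^ (q * (n div B + q * M)) = \<zeta> L ^ (q * (n div B))"
        proof -
          have "q * (n div B + q * M) = q * (n div B) + M * (q * q)" by (simp add: algebra_simps)
          then have "\<zeta> L ^ (q * (n div B + q * M)) = \<zeta> L ^ (q * (n div B)) * (\<zeta> L ^ M) ^ (q * q)"
            by (simp only: power_add power_mult)
          then show ?thesis by (simp add: root)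
        qed
        ultimately show ?thesis
          by (simp add: g_def H_def)
      qed
      then have "has_period_below N Q g" by (simp add: has_period_below_def)
      moreover have "eps_almost_every \<eta> {..<N} (\<lambda>n. cmod (f n - g n) \<le> \<eta>)"
      proof -
        have f_g: "cmod (f n - g n) = cmod (R L (n div B) - \<mu>)" for n
        proof -
          have "n mod B < q ^ Suc L" using \<open>B > 0\<close> by (simp add: B_def)
          from cut[OF this, of "n div B", folded B_def] have "f n = f (B * (n div B)) * H n"
            by (simp add: H_def)
          moreover have "\<zeta> L ^ (q * (n div B)) * cnj (\<zeta> L ^ (q * (n div B))) = 1"
            by (rule unimodular_mult_cnj) (simp add: norm_power)
          then have "f (B * (n div B)) = R L (n div B) * \<zeta> L ^ (q * (n div B))"
            unfolding R_def B_def by (metis mult.assoc mult.commute mult.right_neutral)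
          ultimately have "f n - g n = H n * \<zeta> L ^ (q * (n div B)) * (R L (n div B) - \<mu>)"
            by (simp add: g_def algebra_simps)
          then show ?thesis by (simp add: norm_mult norm_power norm_divide H_def)
        qed
        define Bad where "Bad = {n\<in>{..<N}. \<not> cmod (f n - g n) \<le> \<eta>}"
        have "real (card Bad) * \<eta>\<^sup>2 = (\<Sum>n\<in>Bad. \<eta>\<^sup>2)" by simp
        also have "\<dots> \<le> (\<Sum>n\<in>Bad. (cmod (f n - g n))\<^sup>2)"
          using \<open>\<eta> > 0\<close> by (intro sum_mono power_mono) (auto simp: Bad_def)
        also have "\<dots> \<le> (\<Sum>n<q ^ K * B. (cmod (f n - g n))\<^sup>2)"
          using K by (intro sum_mono2) (auto simp: Bad_def mult.commute)
        also have "\<dots> = (\<Sum>x<q ^ K. \<Sum>k<B. (cmod (R L x - \<mu>))\<^sup>2)"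
          by (simp add: sum_lessThan_mult f_g)
        also have "\<dots> = real B * (\<Sum>x<q ^ K. (cmod (R L x - \<mu>))\<^sup>2)"
          by (simp add: sum_distrib_left)
        also have "\<dots> \<le> real B * (real (q ^ K) * (4 * \<tau>))"
        proof -
          have "(\<Sum>J<K. (2 * \<epsilon> (L + J))\<^sup>2) \<le> 4 * \<tau>"
            using tail[of K] by (simp add: power_mult_distrib flip: sum_distrib_left)
          then have "real (q ^ K) * (\<Sum>J<K. (2 * \<epsilon> (L + J))\<^sup>2) \<le> real (q ^ K) * (4 * \<tau>)"
            by (intro mult_left_mono) auto
          from order_trans[OF \<mu> this] show ?thesis by (rule mult_left_mono) simp
        qed
        also have "\<dots> = real (B * q ^ K) * (4 * \<tau>)" by simp
        also have "\<dots> \<le> real (q * N) * (4 * \<tau>)"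
          using K \<open>\<tau> > 0\<close> by (intro mult_right_mono of_nat_mono) auto
        also have "\<dots> = \<eta> * real N * \<eta>\<^sup>2"
          using q_ge_2 by (auto simp: \<tau>_def power2_eq_square power3_eq_cube)
        finally have "real (card Bad) \<le> \<eta> * real N"
          using \<open>\<eta> > 0\<close> by simp
        moreover have "{..<N} - ({..<N} - Bad) = Bad" by (auto simp: Bad_def)
        ultimately show ?thesis
          unfolding eps_almost_every_def
          by (intro conjI exI[of _ "{..<N} - Bad"]) (auto simp: Bad_def)
      qed
      ultimately show ?thesis by blast
    qed
    with \<open>Q > 0\<close> show ?thesis by blast
  qed
  have "bounded (range f)" by (auto simp: bounded_iff)
  with main show ?thesis unfolding almost_periodic_def by blast
qed

end

section \<open>Rigidity of the shift ratios\<close>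

text \<open>With \<open>\<theta>\<close> the argument of \<open>c ^ M\<close>, rotating
  \<open>c\<close> by \<open>- \<theta> / M\<close> gives an exact root of unity. The chord of the
  angle \<open>\<theta> / M\<close> is no longer than that of \<open>\<theta>\<close>.\<close>

lemma near_root_of_unity:
  fixes c :: complex and M :: nat
  assumes c: "cmod c = 1" and M: "M > 0"
  shows "\<exists>\<zeta>. \<zeta> ^ M = 1 \<and> cmod (\<zeta> - c) \<le> cmod (c ^ M - 1)"
proof -
  define \<theta> where "\<theta> = Arg (c ^ M)"
  define \<zeta> where "\<zeta> = c * exp (\<i> * of_real (- \<theta> / M))"
  have \<theta>: "- pi < \<theta>" "\<theta> \<le> pi" unfolding \<theta>_def using Arg_bounded by auto
  have cM: "c ^ M = exp (\<i> * of_real \<theta>)"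
  proof -
    have "c ^ M \<noteq> 0" using c by auto
    from Arg_eq[OF this] show ?thesis using c by (simp add: \<theta>_def norm_power)
  qed
  have "\<zeta> ^ M = c ^ M * exp (of_nat M * (\<i> * of_real (- \<theta> / M)))"
    by (simp only: \<zeta>_def power_mult_distrib exp_of_nat_mult)
  also have "of_nat M * (\<i> * of_real (- \<theta> / M)) = - (\<i> * of_real \<theta>)"
    using M by simp
  finally have "\<zeta> ^ M = 1" using cM by (simp add: exp_minus)
  moreover have "cmod (\<zeta> - c) \<le> cmod (c ^ M - 1)"
  proof -
    have abs_sin: "\<bar>sin x\<bar> = sin \<bar>x\<bar>" if "\<bar>x\<bar> \<le> pi / 2" for x :: real
      using that sin_ge_zero[of x] sin_ge_zero[of "- x"] pi_gt_zero by (auto simp: abs_if)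
    have le: "\<bar>- \<theta> / M / 2\<bar> \<le> \<bar>\<theta> / 2\<bar>"
    proof -
      have "\<bar>\<theta>\<bar> * 1 \<le> \<bar>\<theta>\<bar> * real M" using M by (intro mult_left_mono) auto
      then show ?thesis using M by (simp add: field_simps)
    qed
    have le': "\<bar>\<theta> / 2\<bar> \<le> pi / 2" using \<theta> by auto
    have "\<zeta> - c = c * (exp (\<i> * of_real (- \<theta> / M)) - 1)"
      by (simp add: \<zeta>_def right_diff_distrib)
    then have "cmod (\<zeta> - c) = 2 * \<bar>sin (- \<theta> / M / 2)\<bar>"
      by (simp only: norm_mult c dist_exp_i_1 mult_1)
    also have "\<dots> = 2 * sin \<bar>- \<theta> / M / 2\<bar>"
      using le le' by (subst abs_sin) linarith+
    also have "\<dots> \<le> 2 * sin \<bar>\<theta> / 2\<bar>"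
      using le le' by (intro mult_left_mono sin_monotone_2pi_le) (auto simp: order_trans[of _ 0])
    also have "\<dots> = cmod (c ^ M - 1)"
      unfolding cM dist_exp_i_1 using le' by (subst abs_sin) auto
    finally show ?thesis .
  qed
  ultimately show ?thesis by blast
qed

text \<open>If adding \<open>m\<close> wrapped around, some \<open>b\<close> with
  \<open>0 < b \<le> m\<close> would make \<open>y + b\<close> a multiple of \<open>n\<close>. Then
  \<open>c + u * b\<close> would be a positive multiple of \<open>n\<close> below \<open>n\<close>.
  This rules out carries when only \<open>u * y\<close> is known to be small.\<close>

lemma mod_add_less_of_cong:
  fixes u y c m n :: nat
  assumes cong: "[u * y = c] (mod n)" and small: "c + u * m < n" and u: "u > 0"
  shows "y mod n + m < n"
proof (rule ccontr)
  assume "\<not> y mod n + m < n"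
  define b where "b = n - y mod n"
  have n: "n > 0" using small by simp
  then have b: "0 < b" "b \<le> m" "y mod n + b = n"
    using \<open>\<not> y mod n + m < n\<close> unfolding b_def by (auto simp: less_imp_le_nat)
  have "[c + u * b = u * (y mod n) + u * b] (mod n)"
    using cong by (intro cong_add cong_refl) (auto simp: cong_def mod_mult_right_eq)
  also have "u * (y mod n) + u * b = u * n" using b(3) by (simp flip: distrib_left)
  also have "[u * n = 0] (mod n)" by (simp add: cong_def)
  finally have "n dvd c + u * b" by (simp add: cong_0_iff)
  moreover have "c + u * b < n"
    using small b(2) by (meson add_le_mono le_less_trans le_refl mult_le_mono2)
  moreover have "0 < c + u * b" using u b by simp
  ultimately show False by (meson dvd_imp_le not_le)
qed

text \<open>Multiplication by the unimodular number \<open>A * cnj B'\<close> exchanges a difference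
  of ratios for a difference of correlations.\<close>

lemma norm_diff_unimodular_products:
  fixes A A' B B' :: complex
  assumes "cmod A = 1" "cmod A' = 1" "cmod B = 1" "cmod B' = 1"
  shows "cmod (A' * cnj A - B' * cnj B) = cmod (A * cnj B - A' * cnj B')"
proof -
  have "A * cnj A = 1" "B' * cnj B' = 1"
    using assms by (simp_all add: unimodular_mult_cnj)
  then have "(A' * cnj A - B' * cnj B) * (A * cnj B') = A' * cnj B' - A * cnj B"
    by algebra
  then have "cmod (A' * cnj A - B' * cnj B) * cmod (A * cnj B') = cmod (A' * cnj B' - A * cnj B)"
    by (metis norm_mult)
  then show ?thesis
    using assms by (simp add: norm_mult norm_minus_commute)
qed

lemma norm_iterate_twisted_shift:
  fixes h :: "nat \<Rightarrow> complex"
  assumes step: "\<And>z. z \<le> Y \<Longrightarrow> cmod (h (z + s) - \<kappa> * h z) \<le> e"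
    and \<kappa>: "cmod \<kappa> = 1" and "y + i * s \<le> Y"
  shows "cmod (h (y + i * s) - \<kappa> ^ i * h y) \<le> real i * e"
  using assms(3)
proof (induction i)
  case 0
  then show ?case by simp
next
  case (Suc i)
  have "cmod (h (y + i * s + s) - \<kappa> * h (y + i * s)) \<le> e"
    using Suc.prems by (intro step) simp
  moreover have "cmod (\<kappa> * (h (y + i * s) - \<kappa> ^ i * h y)) \<le> real i * e"
    using Suc by (simp add: norm_mult \<kappa>)
  moreover have "h (y + Suc i * s) - \<kappa> ^ Suc i * h y =
      (h (y + i * s + s) - \<kappa> * h (y + i * s)) + \<kappa> * (h (y + i * s) - \<kappa> ^ i * h y)"
    by (simp add: algebra_simps)
  ultimately show ?case
    using norm_triangle_ineq[of "h (y + i * s + s) - \<kappa> * h (y + i * s)"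
        "\<kappa> * (h (y + i * s) - \<kappa> ^ i * h y)"] by (simp add: algebra_simps)
qed

lemma norm_diff_from_zero_le:
  fixes g :: "nat \<Rightarrow> complex"
  assumes "\<And>y. y < Y \<Longrightarrow> cmod (g y - g (Suc y)) \<le> e" and "y \<le> Y"
  shows "cmod (g y - g 0) \<le> real y * e"
  using assms(2)
proof (induction y)
  case 0
  then show ?case by simp
next
  case (Suc y)
  then have "cmod (g y - g 0) \<le> real y * e" "cmod (g y - g (Suc y)) \<le> e"
    using assms(1) by auto
  then show ?case
    using norm_triangle_ineq4[of "g y - g 0" "g y - g (Suc y)"] by (simp add: algebra_simps)
qed

text \<open>
  Carries \<open>\<lfloor>p k / q\<^sup>l\<rfloor>\<close> and \<open>\<lfloor>p' k / q\<^sup>l\<rfloor>\<close> that occur for the same \<open>k\<close>: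
  the intervals \<open>[j / p, (j + 1) / p)\<close> and \<open>[j' / p', (j' + 1) / p')\<close> meet.
\<close>

definition compatible_carries :: "nat \<Rightarrow> nat \<Rightarrow> nat \<Rightarrow> nat \<Rightarrow> bool" where
  "compatible_carries p p' j j' \<longleftrightarrow>
     j < p \<and> j' < p' \<and> p' * j < p * Suc j' \<and> p * j' < p' * Suc j"

text \<open>
  Adding \<open>q\<close> to \<open>d\<close> keeps the last digits of \<open>p d + j\<close> and \<open>p' d + j'\<close>, so it does not change how these
  interact with the lower digits.
\<close>

definition shift_invariant :: "nat \<Rightarrow> nat \<Rightarrow> nat \<Rightarrow> nat \<Rightarrow> real \<Rightarrow> (nat \<Rightarrow> complex) \<Rightarrow> bool" where
  "shift_invariant q v p p' \<omega> h \<longleftrightarrow> (\<exists>x x'. \<forall>d j j'. d + q < q ^ v \<and> compatible_carries p p' j j' \<longrightarrow>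
     cmod (h (q ^ v * x + (p * d + j)) * cnj (h (q ^ v * x' + (p' * d + j'))) -
       h (q ^ v * x + (p * (d + q) + j)) * cnj (h (q ^ v * x' + (p' * (d + q) + j')))) \<le> \<omega>)"

context semimultiplicative begin

text \<open>Adding \<open>m\<close> causes no carry into position \<open>w\<close>, so the digit
  there separates the change from the higher digits. Their common factor cancels in the
  ratio.\<close>

lemma ratio_cong:
  assumes "y mod q ^ Suc w = z mod q ^ Suc w" and small: "y mod q ^ w + m < q ^ w"
  shows "f (y + m) * cnj (f y) = f (z + m) * cnj (f z)"
proof -
  define k where "k = y mod q ^ w"
  have eq: "q ^ w * (y div q ^ w mod q) + y mod q ^ w = q ^ w * (z div q ^ w mod q) + z mod q ^ w"
    using assms(1) by (simp only: power_Suc2 mod_mult2_eq)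
  have k: "z mod q ^ w = k"
    using arg_cong[OF eq, of "\<lambda>t. t mod q ^ w"] by (simp add: k_def)
  with eq have d: "z div q ^ w mod q = y div q ^ w mod q"
    using q_pos by (auto simp: k_def)
  define G where "G t = f (q ^ w * (y div q ^ w mod q) + t) / f (q ^ w * (y div q ^ w mod q))" for t
  have G: "f (q ^ w * Y + t) = f (q ^ w * Y) * G t"
    if "t < q ^ w" "Y mod q = y div q ^ w mod q" for Y t
    using cut[OF that(1), of Y] that(2) by (simp add: G_def)
  have "f (x + m) * cnj (f x) = G (k + m) * cnj (G k)"
    if "x mod q ^ w = k" "x div q ^ w mod q = y div q ^ w mod q" for x
  proof -
    define X where "X = q ^ w * (x div q ^ w)"
    have x: "x = X + k" unfolding X_def by (metis that(1) mult_div_mod_eq)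
    have "f (X + (k + m)) = f X * G (k + m)" "f (X + k) = f X * G k"
      using small that by (auto simp: X_def k_def intro!: G)
    moreover have "f X * cnj (f X) = 1" by (simp add: unimodular_mult_cnj)
    ultimately show ?thesis by (simp add: x add.assoc)
  qed
  from this[of y] this[of z] show ?thesis using k d by (simp add: k_def)
qed

text \<open>As \<open>p\<close> is invertible modulo \<open>q ^ Suc w\<close>, the congruence says
  that \<open>y\<close> and \<open>y'\<close> are \<open>p * d + j\<close> and
  \<open>p' * d + j'\<close> for one common \<open>d\<close>. The ratios depend only on these
  residues, so they can be read off from the invariance at \<open>d\<close>.\<close>

lemma shift_ratios_close:
  assumes inv: "shift_invariant q (w + 2) p p' \<omega> f"
    and compat: "compatible_carries p p' j j'" and coprime: "coprime p q"
    and cong: "[p' * y + p * j' = p * y' + p' * j] (mod q ^ Suc w)"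
    and small: "y mod q ^ w + p * q < q ^ w" "y' mod q ^ w + p' * q < q ^ w"
  shows "cmod (f (y + p * q) * cnj (f y) - f (y' + p' * q) * cnj (f y')) \<le> \<omega>"
proof -
  define n where "n = q ^ Suc w"
  have n: "n > 0" by (simp add: n_def)
  have cop: "coprime p n" using coprime by (simp add: n_def)
  obtain r where r: "[p * r = 1] (mod n)"
    using cong_solve_coprime_nat[OF cop] by auto
  \<comment> \<open>The term \<open>(n - 1) * j\<close> represents \<open>- j\<close> modulo
    \<open>n\<close> within the natural numbers.\<close>
  define d where "d = r * (y + (n - 1) * j) mod n"
  have pd: "[p * d + j = y] (mod n)"
  proof -
    have "[p * d = p * r * (y + (n - 1) * j)] (mod n)"
      by (simp add: d_def cong_def mod_mult_right_eq mult.assoc)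
    also have "[p * r * (y + (n - 1) * j) = 1 * (y + (n - 1) * j)] (mod n)"
      by (intro cong_mult r cong_refl)
    finally have "[p * d + j = 1 * (y + (n - 1) * j) + j] (mod n)"
      by (intro cong_add cong_refl)
    also have "1 * (y + (n - 1) * j) + j = y + n * j"
      using n by (cases n) auto
    also have "[y + n * j = y] (mod n)" by (simp add: cong_def)
    finally show ?thesis .
  qed
  have p'd: "[p' * d + j' = y'] (mod n)"
  proof -
    have "[p * (p' * d + j') + p' * j = p' * (p * d + j) + p * j'] (mod n)"
      by (simp add: algebra_simps)
    also have "[p' * (p * d + j) + p * j' = p' * y + p * j'] (mod n)"
      by (intro cong_add cong_mult cong_refl pd)
    also have "[p' * y + p * j' = p * y' + p' * j] (mod n)"
      using cong by (simp add: n_def)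
    finally have "[p * (p' * d + j') = p * y'] (mod n)"
      by (simp add: cong_add_rcancel_nat)
    then show ?thesis using cop by (simp add: cong_mult_lcancel_nat)
  qed
  have "d < n" unfolding d_def using n by simp
  \<comment> \<open>The invariance is assumed for \<open>w + 2\<close> digits although the residues
    live modulo \<open>q ^ Suc w\<close>; the extra digit makes room for
    \<open>d + q\<close>.\<close>
  have "n \<ge> q" by (simp add: n_def Suc_leI)
  moreover have "q ^ (w + 2) \<ge> 2 * n"
    using q_ge_2 mult_le_mono1[of 2 q n] by (simp add: n_def)
  ultimately have dq: "d + q < q ^ (w + 2)"
    using \<open>d < n\<close> by linarith
  from inv obtain x x' where xx': "\<And>d j j'. d + q < q ^ (w + 2) \<Longrightarrow> compatible_carries p p' j j' \<Longrightarrow>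
     cmod (f (q ^ (w + 2) * x + (p * d + j)) * cnj (f (q ^ (w + 2) * x' + (p' * d + j'))) -
       f (q ^ (w + 2) * x + (p * (d + q) + j)) * cnj (f (q ^ (w + 2) * x' + (p' * (d + q) + j')))) \<le> \<omega>"
    unfolding shift_invariant_def by blast
  define z where "z = q ^ (w + 2) * x + (p * d + j)"
  define z' where "z' = q ^ (w + 2) * x' + (p' * d + j')"
  have qn: "q ^ (w + 2) = n * q" by (simp add: n_def)
  have "y mod n = z mod n" "y' mod n = z' mod n"
    using pd p'd unfolding z_def z'_def qn cong_def mult.assoc by simp_all
  then have "f (y + p * q) * cnj (f y) = f (z + p * q) * cnj (f z)"
    "f (y' + p' * q) * cnj (f y') = f (z' + p' * q) * cnj (f z')"
    using small by (auto simp: n_def intro!: ratio_cong[of _ w])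
  then have "cmod (f (y + p * q) * cnj (f y) - f (y' + p' * q) * cnj (f y')) =
     cmod (f (z + p * q) * cnj (f z) - f (z' + p' * q) * cnj (f z'))"
    by simp
  also have "\<dots> = cmod (f z * cnj (f z') - f (z + p * q) * cnj (f (z' + p' * q)))"
    by (rule norm_diff_unimodular_products) auto
  also have "\<dots> \<le> \<omega>"
    using xx'[OF dq compat] by (simp add: z_def z'_def algebra_simps)
  finally show ?thesis .
qed

end

text \<open>Once both shifts, by \<open>p * q\<close> and by \<open>p' * q\<close>, act almost as
  multiplication by one \<open>\<kappa>\<close>, the Bezout relation
  \<open>p' * b = p * a + 1\<close> makes the shift by \<open>q\<close> act as
  \<open>c = \<kappa> ^ b * cnj (\<kappa> ^ a)\<close>. Iterating from \<open>h 0 = 1\<close> gives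
  \<open>c ^ n\<close>.\<close>

lemma local_rigidity:
  fixes q p p' :: nat
  assumes p: "1 < p" "p < p'" and coprime: "coprime p p'" "coprime p q" "coprime p' q" and q: "q \<ge> 2"
  shows "\<exists>C v. \<forall>h \<omega>. semimultiplicative q h \<and> shift_invariant q v p p' \<omega> h \<longrightarrow>
    (\<exists>\<zeta>. \<zeta> ^ (p' - p) = 1 \<and> (\<forall>n<q ^ 3. cmod (h (q * n) - \<zeta> ^ n) \<le> C * \<omega>))"
proof -
  obtain a b where ab: "p' * b = p * a + 1" and b: "0 < b" "b < p" and a: "a < p'"
  proof -
    obtain b0 where "[p' * b0 = 1] (mod p)"
      using cong_solve_coprime_nat[of p' p] coprime by (auto simp: coprime_commute)
    then have "(p' * (b0 mod p)) mod p = 1"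
      using p by (simp add: cong_def mod_mult_right_eq)
    then have *: "p' * (b0 mod p) = p * (p' * (b0 mod p) div p) + 1"
      by (metis mult_div_mod_eq)
    moreover have "0 < b0 mod p" using * by (cases "b0 mod p") auto
    moreover have "b0 mod p < p" using p by simp
    moreover have "p' * (b0 mod p) div p < p'"
      using p by (simp add: div_less_iff_less_mult)
    ultimately show ?thesis using that by blast
  qed
  \<comment> \<open>The base points go up to \<open>q * (q ^ 3 + p')\<close>, to reach
    \<open>c ^ n\<close> for \<open>n < q ^ 3\<close> and also \<open>c ^ p'\<close>; the Bezout
    path adds \<open>b\<close> shifts by \<open>p' * q\<close>.\<close>
  define Y where "Y = q * (q ^ 3 + p' + b * p')"
  define w where "w = p * Y + p' * Y + p' * (p * q) + p * (p' * q) + p' + p' * q + Y + 1"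
  \<comment> \<open>\<open>E\<close> counts \<open>Y\<close> steps of size
    \<open>2 * \<omega>\<close> and one comparison of the two kinds of ratio. \<open>e1\<close>
    counts the \<open>a + b\<close> shifts of the Bezout path, and \<open>C\<close> adds the passage
    from \<open>c\<close> to the root of unity.\<close>
  define E where "E = real (2 * Y + 1)"
  define e1 where "e1 = real (a + b) * E"
  define C where "C = real (q ^ 3) * e1 + real (q ^ 3) * (real (p + p') * e1 + E)"
  have w: "w < q ^ w"
    using q by (intro less_le_trans[OF less_exp] power_mono) auto
  have "\<exists>\<zeta>. \<zeta> ^ (p' - p) = 1 \<and> (\<forall>n<q ^ 3. cmod (h (q * n) - \<zeta> ^ n) \<le> C * \<omega>)"
    if h: "semimultiplicative q h" and inv: "shift_invariant q (w + 2) p p' \<omega> h" for h \<omega>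
  proof -
    interpret semimultiplicative q h by (rule h)
    define \<Delta> where "\<Delta> y = h (y + p * q) * cnj (h y)" for y
    define \<Delta>' where "\<Delta>' y = h (y + p' * q) * cnj (h y)" for y
    note close = shift_ratios_close[OF inv _ coprime(2), folded \<Delta>_def \<Delta>'_def]
    have Y_small: "y mod q ^ w + p * q < q ^ w" "y mod q ^ w + p' * q < q ^ w" if "y \<le> Suc Y" for y
    proof -
      have "p * q \<le> p' * (p * q)" using p by simp
      then have "y + p * q < q ^ w" "y + p' * q < q ^ w"
        using w that p unfolding w_def by linarith+
      then show "y mod q ^ w + p * q < q ^ w" "y mod q ^ w + p' * q < q ^ w"
        by (auto intro: le_less_trans[OF add_right_mono[OF mod_less_eq_dividend]])
    qed
    \<comment> \<open>In this order, \<open>p' * j - p * j'\<close> takes the values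
      \<open>0\<close>, \<open>- p\<close>, \<open>1 - p'\<close> and \<open>1\<close>.\<close>
    have compat: "compatible_carries p p' 0 0" "compatible_carries p p' 0 1"
      "compatible_carries p p' (b - 1) a" "compatible_carries p p' b a"
    proof -
      show "compatible_carries p p' 0 0" "compatible_carries p p' 0 1" "compatible_carries p p' b a"
        using p a b ab by (auto simp: compatible_carries_def)
      obtain b' where b': "b = Suc b'" using b by (cases b) auto
      show "compatible_carries p p' (b - 1) a"
        using p a b ab unfolding b' by (auto simp: compatible_carries_def)
    qed
    have solve: "\<exists>y. [u * y = c] (mod q ^ Suc w)" if "coprime u q" for u c
    proof -
      have "coprime u (q ^ Suc w)" using that by simp
      then obtain r where "[u * r = 1] (mod q ^ Suc w)"
        using cong_solve_coprime_nat[of u "q ^ Suc w"] by (auto simp del: power_Suc)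
      then have "[u * r * c = 1 * c] (mod q ^ Suc w)" by (intro cong_mult cong_refl)
      then show ?thesis by (auto simp: mult.assoc)
    qed
    have weaken: "[u * y = c] (mod q ^ w)" if "[u * y = c] (mod q ^ Suc w)" for u y c
      using that by (rule cong_dvd_modulus_nat) simp
    \<comment> \<open>One \<open>y\<close> with \<open>p' * y\<close> congruent to
      \<open>p * y'\<close> is comparable with \<open>y'\<close> (difference \<open>0\<close>) and
      with \<open>Suc y'\<close> (difference \<open>- p\<close>). It may be huge, hence the no-carry
      lemma.\<close>
    have \<Delta>'_step: "cmod (\<Delta>' y' - \<Delta>' (Suc y')) \<le> 2 * \<omega>" if "y' < Y" for y'
    proof -
      obtain y where y: "[p' * y = p * y'] (mod q ^ Suc w)" using solve coprime by blast
      have "p * y' + p' * (p * q) < q ^ w"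
        using mult_le_mono2[of y' Y p] that w unfolding w_def by linarith
      then have y_small: "y mod q ^ w + p * q < q ^ w"
        using p by (intro mod_add_less_of_cong[OF weaken[OF y]]) auto
      have "cmod (\<Delta> y - \<Delta>' y') \<le> \<omega>"
        using y that by (intro close[OF compat(1)] y_small Y_small) auto
      moreover have "[p' * y + p = p * y' + p] (mod q ^ Suc w)"
        by (intro cong_add cong_refl y)
      then have "cmod (\<Delta> y - \<Delta>' (Suc y')) \<le> \<omega>"
        using that by (intro close[OF compat(2)] y_small Y_small) (auto simp: add.commute)
      ultimately show ?thesis
        using norm_triangle_ineq4[of "\<Delta> y - \<Delta>' (Suc y')" "\<Delta> y - \<Delta>' y'"] by simp
    qed
    \<comment> \<open>Here one \<open>y'\<close> is comparable with \<open>y\<close> (difference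
      \<open>1 - p'\<close>) and with \<open>Suc y\<close> (difference \<open>1\<close>).\<close>
    have \<Delta>_step: "cmod (\<Delta> y - \<Delta> (Suc y)) \<le> 2 * \<omega>" if "y < Y" for y
    proof -
      obtain y' where y': "[p * y' = p' * y + (p' - 1)] (mod q ^ Suc w)" using solve coprime by blast
      have "p' * y + (p' - 1) + p * (p' * q) < q ^ w"
        using mult_le_mono2[of y Y p'] that w unfolding w_def by linarith
      then have y'_small: "y' mod q ^ w + p' * q < q ^ w"
        using p by (intro mod_add_less_of_cong[OF weaken[OF y']]) auto
      obtain b' where b': "b = Suc b'" using b by (cases b) auto
      have "[p' * y + p * a = p * y' + p' * (b - 1)] (mod q ^ Suc w)"
      proof -
        have "p' * y + p * a = p' * y + (p' - 1) + p' * (b - 1)"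
          using ab p unfolding b' by simp
        then show ?thesis using cong_add[OF y' cong_refl, of "p' * (b - 1)"] by (metis cong_sym)
      qed
      then have "cmod (\<Delta> y - \<Delta>' y') \<le> \<omega>"
        using that by (intro close[OF compat(3)] y'_small Y_small) auto
      moreover have "[p' * Suc y + p * a = p * y' + p' * b] (mod q ^ Suc w)"
      proof -
        have "p' * Suc y + p * a = p' * y + (p' - 1) + p' * b"
          using ab p by simp
        then show ?thesis using cong_add[OF y' cong_refl, of "p' * b"] by (metis cong_sym)
      qed
      then have "cmod (\<Delta> (Suc y) - \<Delta>' y') \<le> \<omega>"
        using that by (intro close[OF compat(4)] y'_small Y_small) auto
      ultimately show ?thesis
        using norm_triangle_ineq4[of "\<Delta> y - \<Delta>' y'" "\<Delta> (Suc y) - \<Delta>' y'"] by simp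
    qed
    have \<Delta>_0: "cmod (\<Delta> 0 - \<Delta>' 0) \<le> \<omega>"
      by (intro close[OF compat(1)] Y_small) auto
    have \<omega>: "\<omega> \<ge> 0" using \<Delta>_0 norm_ge_zero order_trans by blast
    define \<kappa> where "\<kappa> = \<Delta> 0"
    have \<kappa>: "cmod \<kappa> = 1" by (simp add: \<kappa>_def \<Delta>_def norm_mult)
    have \<Delta>_close: "cmod (\<Delta> y - \<kappa>) \<le> E * \<omega>" if "y \<le> Y" for y
    proof -
      have "cmod (\<Delta> y - \<kappa>) \<le> real y * (2 * \<omega>)"
        unfolding \<kappa>_def using \<Delta>_step that by (rule norm_diff_from_zero_le)
      also have "\<dots> \<le> real Y * (2 * \<omega>)" using that \<omega> by (intro mult_right_mono) auto
      also have "\<dots> \<le> E * \<omega>" using \<omega> by (simp add: E_def algebra_simps)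
      finally show ?thesis .
    qed
    have \<Delta>'_close: "cmod (\<Delta>' y - \<kappa>) \<le> E * \<omega>" if "y \<le> Y" for y
    proof -
      have "cmod (\<Delta>' y - \<Delta>' 0) \<le> real y * (2 * \<omega>)"
        using \<Delta>'_step that by (rule norm_diff_from_zero_le)
      also have "\<dots> \<le> real Y * (2 * \<omega>)" using that \<omega> by (intro mult_right_mono) auto
      finally have "cmod (\<Delta>' y - \<Delta>' 0) \<le> real Y * (2 * \<omega>)" .
      then show ?thesis
        using norm_triangle_ineq4[of "\<Delta>' y - \<Delta>' 0" "\<kappa> - \<Delta>' 0"] \<Delta>_0
        by (simp add: E_def \<kappa>_def algebra_simps)
    qed
    have ratio: "cmod (h (z + s) - \<kappa> * h z) = cmod (h (z + s) * cnj (h z) - \<kappa>)" for z s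
    proof -
      have "(h (z + s) * cnj (h z) - \<kappa>) * h z = h (z + s) - \<kappa> * h z"
        using unimodular_mult_cnj[of "h z"] by (simp add: algebra_simps)
      then show ?thesis by (metis norm_mult norm_f mult.right_neutral)
    qed
    have p_shift: "cmod (h (z + p * q) - \<kappa> * h z) \<le> E * \<omega>" if "z \<le> Y" for z
      using \<Delta>_close[OF that] by (simp add: ratio \<Delta>_def)
    have p'_shift: "cmod (h (z + p' * q) - \<kappa> * h z) \<le> E * \<omega>" if "z \<le> Y" for z
      using \<Delta>'_close[OF that] by (simp add: ratio \<Delta>'_def)
    define c where "c = \<kappa> ^ b * cnj (\<kappa> ^ a)"
    have c: "cmod c = 1" by (simp add: c_def norm_mult norm_power \<kappa>)
    have q_shift: "cmod (h (z + q) - c * h z) \<le> e1 * \<omega>" if "z \<le> q * (q ^ 3 + p')" for z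
    proof -
      have eq: "z + b * (p' * q) = z + q + a * (p * q)"
      proof -
        have "b * (p' * q) = p' * b * q" by (simp add: mult_ac)
        also have "\<dots> = q + a * (p * q)" by (simp only: ab) (simp add: algebra_simps)
        finally show ?thesis by simp
      qed
      have le: "z + b * (p' * q) \<le> Y"
        using that by (simp add: Y_def algebra_simps)
      have "cmod (h (z + b * (p' * q)) - \<kappa> ^ b * h z) \<le> real b * (E * \<omega>)"
        by (rule norm_iterate_twisted_shift[where h = h and s = "p' * q", OF p'_shift \<kappa> le])
      moreover have "cmod (h (z + q + a * (p * q)) - \<kappa> ^ a * h (z + q)) \<le> real a * (E * \<omega>)"
        by (rule norm_iterate_twisted_shift[where h = h and s = "p * q", OF p_shift \<kappa>]) (use le eq in simp_all)
      ultimately have "cmod (\<kappa> ^ a * h (z + q) - \<kappa> ^ b * h z) \<le> e1 * \<omega>"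
        using norm_triangle_ineq4[of "h (z + b * (p' * q)) - \<kappa> ^ b * h z"
            "h (z + b * (p' * q)) - \<kappa> ^ a * h (z + q)"] unfolding eq
        by (simp add: e1_def algebra_simps)
      moreover have "(\<kappa> ^ a * h (z + q) - \<kappa> ^ b * h z) * cnj (\<kappa> ^ a) = h (z + q) - c * h z"
        using unimodular_mult_cnj[of "\<kappa> ^ a"] \<kappa> unfolding c_def
        by (simp add: norm_power algebra_simps del: complex_cnj_power)
      then have "cmod (h (z + q) - c * h z) = cmod (\<kappa> ^ a * h (z + q) - \<kappa> ^ b * h z) * cmod (cnj (\<kappa> ^ a))"
        by (metis norm_mult)
      ultimately show ?thesis by (simp add: norm_power \<kappa>)
    qed
    have char: "cmod (h (n * q) - c ^ n) \<le> real n * (e1 * \<omega>)" if "n \<le> q ^ 3 + p'" for n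
      using norm_iterate_twisted_shift[where h = h and s = q and y = 0 and i = n, OF q_shift c] that by (simp add: mult.commute)
    \<comment> \<open>Both \<open>c ^ p\<close> and \<open>c ^ p'\<close> are close to
      \<open>\<kappa>\<close>, because \<open>h (p * q) = \<kappa>\<close> exactly and
      \<open>h (p' * q)\<close> is near it.\<close>
    have "cmod (c ^ (p' - p) - 1) \<le> (real (p + p') * e1 + E) * \<omega>"
    proof -
      have "c ^ p * (c ^ (p' - p) - 1) = c ^ p' - c ^ p"
        using p by (simp add: right_diff_distrib flip: power_add)
      then have "cmod (c ^ (p' - p) - 1) = cmod (c ^ p' - c ^ p)"
        using c by (metis norm_mult norm_power power_one mult_1)
      also have "c ^ p' - c ^ p = (c ^ p' - h (p' * q)) + (h (p' * q) - \<kappa>) + (h (p * q) - c ^ p)"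
        by (simp add: \<kappa>_def \<Delta>_def)
      also have "cmod \<dots> \<le> cmod (c ^ p' - h (p' * q)) + cmod (h (p' * q) - \<kappa>) + cmod (h (p * q) - c ^ p)"
        by (intro order_trans[OF norm_triangle_ineq] add_mono norm_triangle_ineq) auto
      also have "\<dots> \<le> real p' * (e1 * \<omega>) + E * \<omega> + real p * (e1 * \<omega>)"
      proof (intro add_mono)
        show "cmod (c ^ p' - h (p' * q)) \<le> real p' * (e1 * \<omega>)"
          using char[of p'] by (simp add: norm_minus_commute)
        show "cmod (h (p' * q) - \<kappa>) \<le> E * \<omega>"
          using p'_shift[of 0] by simp
        show "cmod (h (p * q) - c ^ p) \<le> real p * (e1 * \<omega>)"
          using char[of p] p by simp
      qed
      finally show ?thesis by (simp add: algebra_simps)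
    qed
    moreover obtain \<zeta> where \<zeta>: "\<zeta> ^ (p' - p) = 1" "cmod (\<zeta> - c) \<le> cmod (c ^ (p' - p) - 1)"
      using near_root_of_unity[OF c, of "p' - p"] p by auto
    ultimately have \<zeta>c: "cmod (\<zeta> - c) \<le> (real (p + p') * e1 + E) * \<omega>" by linarith
    have norm_\<zeta>: "cmod \<zeta> = 1"
      using power_eq_1_iff[OF \<zeta>(1)] p by auto
    have e1: "e1 \<ge> 0" "E \<ge> 0" by (auto simp: e1_def E_def)
    have "cmod (h (q * n) - \<zeta> ^ n) \<le> C * \<omega>" if "n < q ^ 3" for n
    proof -
      have "cmod (h (q * n) - c ^ n) \<le> real (q ^ 3) * (e1 * \<omega>)"
        using char[of n] that e1 \<omega> mult_right_mono[of "real n" "real (q ^ 3)" "e1 * \<omega>"]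
        by (simp add: mult.commute less_imp_le)
      moreover have "cmod (\<zeta> ^ n - c ^ n) \<le> real (q ^ 3) * ((real (p + p') * e1 + E) * \<omega>)"
      proof -
        have "cmod (\<zeta> ^ n - c ^ n) \<le> real n * cmod (\<zeta> - c)"
          using norm_\<zeta> c by (intro norm_power_diff) auto
        also have "\<dots> \<le> real (q ^ 3) * ((real (p + p') * e1 + E) * \<omega>)"
          using that \<zeta>c by (intro mult_mono) (auto simp: less_imp_le)
        finally show ?thesis .
      qed
      ultimately have "cmod (h (q * n) - \<zeta> ^ n) \<le>
          real (q ^ 3) * (e1 * \<omega>) + real (q ^ 3) * ((real (p + p') * e1 + E) * \<omega>)"
        using norm_triangle_ineq4[of "h (q * n) - c ^ n" "\<zeta> ^ n - c ^ n"] by simp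
      then show ?thesis by (simp add: C_def algebra_simps)
    qed
    with \<zeta>(1) show ?thesis by blast
  qed
  then show ?thesis by blast
qed

section \<open>Averages of correlations\<close>

text \<open>Compatibility makes the real intervals \<open>[n j / p, n (j + 1) / p)\<close> and
  \<open>[n j' / p', n (j' + 1) / p')\<close> overlap in length at least
  \<open>n / (p p') \<ge> 2\<close>. Rounding up the larger left end leaves space for a full unit
  step, which gives \<open>z + p \<le> n\<close> and \<open>z' + p' \<le> n\<close>.\<close>

lemma exists_multiple_in_window:
  fixes n p p' j j' :: nat
  assumes compat: "compatible_carries p p' j j'" and n: "2 * p * p' \<le> n"
  shows "\<exists>e z z'. e < n \<and> p * e = n * j + z \<and> z + p \<le> n \<and> p' * e = n * j' + z' \<and> z' + p' \<le> n"
proof -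
  \<comment> \<open>The case in which \<open>n * j / p\<close> rounded up also satisfies the other
    lower bound; exchanging the roles of \<open>p\<close> and \<open>p'\<close> gives the remaining
    case.\<close>
  have one: "\<exists>e z z'. e < n \<and> p * e = n * j + z \<and> z + p \<le> n \<and> p' * e = n * j' + z' \<and> z' + p' \<le> n"
    if compat: "compatible_carries p p' j j'" and n: "2 * p * p' \<le> n"
      and e: "n * j \<le> p * e" "p * e < n * j + p" "n * j' \<le> p' * e" for p p' j j' e :: nat
  proof -
    have pos: "p > 0" "p' > 0" using compat by (auto simp: compatible_carries_def)
    then have "2 * p * 1 \<le> 2 * p * p'" by (intro mult_le_mono2) simp
    then have p_e: "p * e + p \<le> n * j + n" using n e by linarith
    have "p * (p' * e + p') = p' * (p * e) + p * p'" by (simp add: algebra_simps)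
    also have "\<dots> \<le> p' * (n * j + p) + p * p'" using e by (intro add_mono mult_le_mono2) auto
    also have "\<dots> = n * (p' * j) + 2 * p * p'" by (simp add: algebra_simps)
    also have "\<dots> \<le> n * Suc (p' * j)" using n by simp
    also have "\<dots> \<le> n * (p * Suc j')"
      using compat by (intro mult_le_mono2) (auto simp: compatible_carries_def)
    also have "\<dots> = p * (n * j' + n)" by (simp add: algebra_simps)
    finally have p'_e: "p' * e + p' \<le> n * j' + n" using pos by simp
    have "p * e < n * j + n" using p_e pos by linarith
    also have "\<dots> = n * Suc j" by simp
    also have "\<dots> \<le> n * p" using compat by (intro mult_le_mono2) (auto simp: compatible_carries_def)
    finally have "e < n" by (simp add: mult.commute)
    then show ?thesis
      using e p_e p'_e by (intro exI[of _ e] exI[of _ "p * e - n * j"] exI[of _ "p' * e - n * j'"]) auto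
  qed
  have ceil: "\<exists>e. a \<le> b * e \<and> b * e < a + b" if "b > 0" for a b :: nat
  proof -
    have "a + b - 1 = b * ((a + b - 1) div b) + (a + b - 1) mod b" by simp
    moreover have "(a + b - 1) mod b < b" using that by simp
    ultimately show ?thesis by (intro exI[of _ "(a + b - 1) div b"]) linarith
  qed
  have pos: "p > 0" "p' > 0" using compat by (auto simp: compatible_carries_def)
  obtain e where e: "n * j \<le> p * e" "p * e < n * j + p" using ceil[OF pos(1)] by blast
  obtain e' where e': "n * j' \<le> p' * e'" "p' * e' < n * j' + p'" using ceil[OF pos(2)] by blast
  show ?thesis
  proof (cases "n * j' \<le> p' * e")
    case True
    then show ?thesis using one[OF compat n] e by blast
  next
    case False
    then have "p' * e < p' * e'" using e' by linarith
    then have "p * e \<le> p * e'" by simp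
    then have "n * j \<le> p * e'" using e by linarith
    moreover have "compatible_carries p' p j' j" "2 * p' * p \<le> n"
      using compat n by (auto simp: compatible_carries_def mult_ac)
    ultimately show ?thesis using one[of p' p j' j e'] e' by blast
  qed
qed

context semimultiplicative begin

text \<open>
  The numbers \<open>x\<close> and \<open>x'\<close> stand for the digits above position \<open>l\<close>: the average of
  \<open>f (p n) * cnj (f (p' n))\<close> over \<open>q\<^sup>l x \<le> n < q\<^sup>l (x + 1)\<close> is \<open>corr p p' l (p x) (p' x)\<close>.
\<close>

definition corr :: "nat \<Rightarrow> nat \<Rightarrow> nat \<Rightarrow> nat \<Rightarrow> nat \<Rightarrow> complex" where
  "corr p p' l x x' =
     (\<Sum>k<q ^ l. f (q ^ l * x + p * k) * cnj (f (q ^ l * x' + p' * k))) / of_nat (q ^ l)"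

definition corr_sup :: "nat \<Rightarrow> nat \<Rightarrow> nat \<Rightarrow> real" where
  "corr_sup p p' l = (SUP (x, x'). cmod (corr p p' l x x'))"

lemma norm_corr_le_1: "cmod (corr p p' l x x') \<le> 1"
  unfolding corr_def by (rule norm_mean_le) (auto simp: norm_mult)

lemma bdd_above_corr: "bdd_above (range (\<lambda>(x, x'). cmod (corr p p' l x x')))"
  by (auto intro!: bdd_aboveI[of _ 1] norm_corr_le_1)

lemma norm_corr_le_sup: "cmod (corr p p' l x x') \<le> corr_sup p p' l"
  using cSUP_upper[OF _ bdd_above_corr[of p p' l], of "(x, x')"] by (simp add: corr_sup_def)

lemma corr_sup_leI: "(\<And>x x'. cmod (corr p p' l x x') \<le> K) \<Longrightarrow> corr_sup p p' l \<le> K"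
  unfolding corr_sup_def by (rule cSUP_least) auto

lemma corr_add:
  "corr p p' (l + T) x x' =
     (\<Sum>D<q ^ T. corr p p' l (q ^ T * x + p * D) (q ^ T * x' + p' * D)) / of_nat (q ^ T)"
proof -
  have "(\<Sum>k<q ^ T * q ^ l. f (q ^ (l + T) * x + p * k) * cnj (f (q ^ (l + T) * x' + p' * k))) =
      (\<Sum>D<q ^ T. \<Sum>k<q ^ l. f (q ^ l * (q ^ T * x + p * D) + p * k) *
         cnj (f (q ^ l * (q ^ T * x' + p' * D) + p' * k)))"
    unfolding sum_lessThan_mult by (simp add: power_add algebra_simps)
  then show ?thesis
    by (simp add: corr_def power_add mult.commute sum_divide_distrib)
qed

lemma corr_sup_add_le: "corr_sup p p' (l + T) \<le> corr_sup p p' l"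
  by (rule corr_sup_leI) (auto simp only: corr_add intro!: norm_mean_le norm_corr_le_sup zero_less_power q_pos)

lemma corr_sup_nonneg: "0 \<le> corr_sup p p' l"
  using norm_corr_le_sup[of p p' l 0 0] norm_ge_zero order_trans by blast

text \<open>The \<open>q ^ T\<close> averages have modulus at most \<open>corr_sup p p' l\<close>,
  while \<open>B\<close>, their mean, is chosen to nearly attain the supremum at level
  \<open>l + T\<close>. So their variance is small. Bounding a single deviation by the whole sum
  costs the factor \<open>q ^ T\<close>.\<close>

lemma corr_nearly_constant:
  assumes "t > 0"
  shows "\<exists>x x' B. cmod B \<ge> corr_sup p p' (l + T) - t \<and> (\<forall>D<q ^ T.
    (cmod (corr p p' l (q ^ T * x + p * D) (q ^ T * x' + p' * D) - B))\<^sup>2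
      \<le> 2 * real (q ^ T) * (corr_sup p p' l - corr_sup p p' (l + T) + t))"
proof -
  have "corr_sup p p' (l + T) - t < corr_sup p p' (l + T)" using assms by simp
  then obtain x x' where xx': "corr_sup p p' (l + T) - t < cmod (corr p p' (l + T) x x')"
    using less_cSupD[of "range (\<lambda>(x, x'). cmod (corr p p' (l + T) x x'))" "corr_sup p p' (l + T) - t"]
    by (auto simp: corr_sup_def)
  define B where "B = corr p p' (l + T) x x'"
  define z where "z D = corr p p' l (q ^ T * x + p * D) (q ^ T * x' + p' * D)" for D
  define a where "a = corr_sup p p' l"
  have a: "a \<le> 1" unfolding a_def by (rule corr_sup_leI) (rule norm_corr_le_1)
  have B_le: "cmod B \<le> a"
    unfolding B_def a_def using norm_corr_le_sup corr_sup_add_le order_trans by blast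
  have "(\<Sum>D<q ^ T. (cmod (z D - B))\<^sup>2) = (\<Sum>D<q ^ T. (cmod (z D))\<^sup>2) - real (q ^ T) * (cmod B)\<^sup>2"
    by (rule sum_norm_diff_mean) (simp add: B_def corr_add z_def scaleR_conv_of_real)
  also have "(\<Sum>D<q ^ T. (cmod (z D))\<^sup>2) \<le> of_nat (card {..<q ^ T}) * a\<^sup>2"
    by (rule sum_bounded_above) (auto simp: z_def a_def intro!: power_mono norm_corr_le_sup)
  also have "of_nat (card {..<q ^ T}) * a\<^sup>2 - real (q ^ T) * (cmod B)\<^sup>2 =
      real (q ^ T) * ((a + cmod B) * (a - cmod B))"
    by (simp add: power2_eq_square algebra_simps)
  also have "\<dots> \<le> real (q ^ T) * (2 * (a - corr_sup p p' (l + T) + t))"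
    using a B_le xx' by (intro mult_left_mono mult_mono) (auto simp: B_def)
  finally have total: "(\<Sum>D<q ^ T. (cmod (z D - B))\<^sup>2) \<le> 2 * real (q ^ T) * (a - corr_sup p p' (l + T) + t)"
    by (simp add: algebra_simps)
  have "(cmod (z D - B))\<^sup>2 \<le> 2 * real (q ^ T) * (a - corr_sup p p' (l + T) + t)" if "D < q ^ T" for D
    using total member_le_sum[of D "{..<q ^ T}" "\<lambda>D. (cmod (z D - B))\<^sup>2"] that by simp
  then show ?thesis
    using xx' unfolding z_def a_def B_def by (intro exI[of _ x] exI[of _ x'] exI conjI) auto
qed

text \<open>The bounds on \<open>z\<close> and \<open>z'\<close> keep every
  \<open>q ^ l * z + p * k\<close> and \<open>q ^ l * z' + p' * k\<close> below
  \<open>q ^ (l + u)\<close>, so \<open>Y\<close> and \<open>Y'\<close> enter the sum over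
  \<open>k\<close> only through their last digits.\<close>

lemma corr_factorization:
  assumes z: "z + p \<le> q ^ u" "z' + p' \<le> q ^ u" and pos: "p > 0" "p' > 0"
  shows "\<exists>G. \<forall>Y Y'. corr p p' l (q ^ u * Y + z) (q ^ u * Y' + z') =
    f (q ^ (l + u) * Y) * cnj (f (q ^ (l + u) * Y')) * G (Y mod q) (Y' mod q)"
proof -
  define F where "F z p m k = f (q ^ (l + u) * m + (q ^ l * z + p * k)) / f (q ^ (l + u) * m)" for z p m k
  have F: "f (q ^ l * (q ^ u * Y + z) + p * k) = f (q ^ (l + u) * Y) * F z p (Y mod q) k"
    if "k < q ^ l" "z + p \<le> q ^ u" "p > 0" for z p k Y
  proof -
    have "q ^ l * z + p * k < q ^ l * z + p * q ^ l" using that by simp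
    also have "\<dots> = q ^ l * (z + p)" by (simp add: algebra_simps)
    also have "\<dots> \<le> q ^ (l + u)" using that by (simp add: power_add)
    finally have "q ^ l * z + p * k < q ^ (l + u)" .
    from cut[OF this, of Y] show ?thesis
      unfolding F_def by (simp add: power_add algebra_simps)
  qed
  define G where "G m m' = (\<Sum>k<q ^ l. F z p m k * cnj (F z' p' m' k)) / of_nat (q ^ l)" for m m'
  have "corr p p' l (q ^ u * Y + z) (q ^ u * Y' + z') =
    f (q ^ (l + u) * Y) * cnj (f (q ^ (l + u) * Y')) * G (Y mod q) (Y' mod q)" for Y Y'
  proof -
    have "(\<Sum>k<q ^ l. f (q ^ l * (q ^ u * Y + z) + p * k) * cnj (f (q ^ l * (q ^ u * Y' + z') + p' * k))) =
      (\<Sum>k<q ^ l. f (q ^ (l + u) * Y) * cnj (f (q ^ (l + u) * Y')) *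
        (F z p (Y mod q) k * cnj (F z' p' (Y' mod q) k)))"
    proof (rule sum.cong[OF refl])
      fix k assume "k \<in> {..<q ^ l}"
      then have "k < q ^ l" by simp
      show "f (q ^ l * (q ^ u * Y + z) + p * k) * cnj (f (q ^ l * (q ^ u * Y' + z') + p' * k)) =
        f (q ^ (l + u) * Y) * cnj (f (q ^ (l + u) * Y')) *
        (F z p (Y mod q) k * cnj (F z' p' (Y' mod q) k))"
        unfolding F[OF \<open>k < q ^ l\<close> z(1) pos(1)] F[OF \<open>k < q ^ l\<close> z(2) pos(2)]
        by (simp only: complex_cnj_mult mult_ac)
    qed
    then show ?thesis
      unfolding corr_def G_def by (simp add: sum_distrib_left)
  qed
  then show ?thesis by blast
qed

text \<open>Adding \<open>q\<close> to \<open>d\<close> preserves the last digits of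
  \<open>Y\<close> and \<open>Y'\<close>, so both correlations share a factor \<open>g\<close>.
  Since they are close to \<open>B\<close>, this factor has modulus at least \<open>\<beta>\<close>
  and can be divided out.\<close>

lemma shift_invariant_if_corr_nearly_constant:
  assumes u: "2 * p * p' \<le> q ^ u" and \<beta>: "\<beta> > 0" "\<beta> \<le> cmod B - \<eta>"
    and const: "\<And>D. D < q ^ (u + v) \<Longrightarrow>
      cmod (corr p p' l (q ^ (u + v) * x + p * D) (q ^ (u + v) * x' + p' * D) - B) \<le> \<eta>"
  shows "shift_invariant q v p p' (2 * \<eta> / \<beta>) (\<lambda>n. f (q ^ (l + u) * n))"
  unfolding shift_invariant_def
proof (rule exI[of _ x], rule exI[of _ x'], intro allI impI, elim conjE)
  fix d j j' assume d: "d + q < q ^ v" and compat: "compatible_carries p p' j j'"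
  then have pos: "p > 0" "p' > 0" by (auto simp: compatible_carries_def)
  \<comment> \<open>The low part \<open>e\<close> of \<open>D = q ^ u * d + e\<close> is chosen to
    produce exactly the carries \<open>j\<close> and \<open>j'\<close> into
    \<open>d\<close>.\<close>
  obtain e z z' where e: "e < q ^ u" "p * e = q ^ u * j + z" "z + p \<le> q ^ u"
    "p' * e = q ^ u * j' + z'" "z' + p' \<le> q ^ u"
    using exists_multiple_in_window[OF compat u] by blast
  define Y where "Y d = q ^ v * x + (p * d + j)" for d
  define Y' where "Y' d = q ^ v * x' + (p' * d + j')" for d
  define U where "U d = f (q ^ (l + u) * Y d) * cnj (f (q ^ (l + u) * Y' d))" for d
  define K where "K d = corr p p' l (q ^ u * Y d + z) (q ^ u * Y' d + z')" for d
  have norm_U: "cmod (U d) = 1" for d by (simp add: U_def norm_mult)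
  have K_close: "cmod (K d - B) \<le> \<eta>" if "d < q ^ v" for d
  proof -
    have "q ^ u * d + e < q ^ u * Suc d" using e by simp
    also have "\<dots> \<le> q ^ (u + v)" unfolding power_add using that by (intro mult_le_mono2) simp
    finally have "q ^ u * d + e < q ^ (u + v)" .
    moreover have "q ^ (u + v) * x + p * (q ^ u * d + e) = q ^ u * Y d + z"
      "q ^ (u + v) * x' + p' * (q ^ u * d + e) = q ^ u * Y' d + z'"
      unfolding distrib_left e(2,4) by (simp_all add: Y_def Y'_def power_add algebra_simps)
    ultimately show ?thesis
      using const[of "q ^ u * d + e"] by (simp add: K_def)
  qed
  obtain G where G: "\<And>d. K d = U d * G (Y d mod q) (Y' d mod q)"
    using corr_factorization[OF e(3,5) pos, of l] unfolding K_def U_def by blast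
  have "Y (d + q) = Y d + p * q" "Y' (d + q) = Y' d + p' * q"
    by (simp_all add: Y_def Y'_def algebra_simps)
  then have "Y (d + q) mod q = Y d mod q" "Y' (d + q) mod q = Y' d mod q"
    by simp_all
  then obtain g where g: "K d = U d * g" "K (d + q) = U (d + q) * g"
    using G by metis
  have "\<beta> \<le> cmod g"
  proof -
    have "cmod B \<le> cmod (K d) + \<eta>"
      using K_close[of d] d norm_triangle_ineq3[of B "K d"] by (simp add: norm_minus_commute)
    then show ?thesis using \<beta> by (simp add: g norm_mult norm_U)
  qed
  have "cmod (U d - U (d + q)) * \<beta> \<le> cmod (U d - U (d + q)) * cmod g"
    using \<open>\<beta> \<le> cmod g\<close> by (intro mult_left_mono) auto
  also have "\<dots> = cmod (K d - K (d + q))"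
    unfolding g by (metis left_diff_distrib norm_mult)
  also have "\<dots> \<le> 2 * \<eta>"
    using norm_triangle_ineq4[of "K d - B" "K (d + q) - B"] K_close[of d] K_close[of "d + q"] d by simp
  finally show "cmod (f (q ^ (l + u) * (q ^ v * x + (p * d + j))) *
      cnj (f (q ^ (l + u) * (q ^ v * x' + (p' * d + j')))) -
      f (q ^ (l + u) * (q ^ v * x + (p * (d + q) + j))) *
      cnj (f (q ^ (l + u) * (q ^ v * x' + (p' * (d + q) + j'))))) \<le> 2 * \<eta> / \<beta>"
    using \<beta> by (simp add: U_def Y_def Y'_def pos_le_divide_eq)
qed

end

section \<open>The dichotomy for one coprime pair\<close>

lemma summable_diff_shift:
  fixes a :: "nat \<Rightarrow> real"
  assumes "convergent a"
  shows "summable (\<lambda>l. a l - a (l + T))"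
proof -
  have "summable (\<lambda>l. a l - a (Suc l))"
    using assms telescope_summable' by (auto simp: convergent_def)
  then have "summable (\<lambda>l. \<Sum>i<T. a (l + i) - a (Suc (l + i)))"
    by (intro summable_sum) (simp add: summable_iff_shift[of "\<lambda>l. a l - a (Suc l)"])
  moreover have "(\<Sum>i<T. a (l + i) - a (Suc (l + i))) = a l - a (l + T)" for l
    using sum_lessThan_telescope'[of "\<lambda>i. a (l + i)" T] by simp
  ultimately show ?thesis by simp
qed

context semimultiplicative begin

lemma average_norm_le:
  assumes "N > 0"
  shows "cmod ((\<Sum>n<N. f (p * n) * cnj (f (p' * n))) / of_nat N) \<le> corr_sup p p' l + real (q ^ l) / real N"
proof -
  define F where "F n = f (p * n) * cnj (f (p' * n))" for n
  define m where "m = N div q ^ l"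
  have norm_F: "cmod (F n) = 1" for n by (simp add: F_def norm_mult)
  have N: "m * q ^ l \<le> N" "N \<le> m * q ^ l + q ^ l"
  proof -
    have "N = m * q ^ l + N mod q ^ l" unfolding m_def by (rule div_mult_mod_eq[symmetric])
    moreover have "N mod q ^ l < q ^ l" by simp
    ultimately show "m * q ^ l \<le> N" "N \<le> m * q ^ l + q ^ l" by linarith+
  qed
  have block: "cmod (\<Sum>k<q ^ l. F (q ^ l * x + k)) \<le> real (q ^ l) * corr_sup p p' l" for x
  proof -
    have "(\<Sum>k<q ^ l. F (q ^ l * x + k)) = of_nat (q ^ l) * corr p p' l (p * x) (p' * x)"
      by (simp add: F_def corr_def algebra_simps)
    then show ?thesis
      using norm_corr_le_sup[of p p' l "p * x" "p' * x"]
      by (simp add: norm_mult norm_power mult_left_mono)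
  qed
  have "cmod (\<Sum>n<m * q ^ l. F n) \<le> of_nat (card {..<m}) * (real (q ^ l) * corr_sup p p' l)"
    unfolding sum_lessThan_mult by (rule sum_norm_bound) (rule block)
  also have "\<dots> = real (m * q ^ l) * corr_sup p p' l" by simp
  also have "\<dots> \<le> real N * corr_sup p p' l"
    using N corr_sup_nonneg by (intro mult_right_mono of_nat_mono) auto
  finally have low: "cmod (\<Sum>n<m * q ^ l. F n) \<le> real N * corr_sup p p' l" .
  have "cmod (\<Sum>n\<in>{m * q ^ l..<N}. F n) \<le> of_nat (card {m * q ^ l..<N}) * 1"
    by (rule sum_norm_bound) (simp add: norm_F)
  also have "\<dots> \<le> real (q ^ l)"
    unfolding card_atLeastLessThan mult_1_right of_nat_le_iff using N by linarith
  finally have high: "cmod (\<Sum>n\<in>{m * q ^ l..<N}. F n) \<le> real (q ^ l)" .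
  have "(\<Sum>n<N. F n) = (\<Sum>n<m * q ^ l. F n) + (\<Sum>n\<in>{m * q ^ l..<N}. F n)"
    using N(1) sum.atLeastLessThan_concat[of 0 "m * q ^ l" N F] by (simp add: atLeast0LessThan)
  then have "cmod (\<Sum>n<N. F n) \<le> real N * corr_sup p p' l + real (q ^ l)"
    using norm_triangle_mono[OF low high] by simp
  then show ?thesis
    using assms by (simp add: F_def norm_divide field_simps)
qed

lemma average_tendsto_0:
  assumes "corr_sup p p' \<longlonglongrightarrow> 0"
  shows "(\<lambda>N. (\<Sum>n<N. f (p * n) * cnj (f (p' * n))) / of_nat N) \<longlonglongrightarrow> 0"
proof (rule tendstoI)
  fix \<epsilon> :: real assume "\<epsilon> > 0"
  then have "\<forall>\<^sub>F l in sequentially. corr_sup p p' l < \<epsilon> / 2"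
    using assms by (intro order_tendstoD(2)) auto
  then obtain l where l: "corr_sup p p' l < \<epsilon> / 2"
    by (auto simp: eventually_sequentially)
  have "(\<lambda>N. real (q ^ l) / real N) \<longlonglongrightarrow> 0"
    by (rule tendsto_divide_0[OF tendsto_const filterlim_at_top_imp_at_infinity[OF filterlim_real_sequentially]])
  then have "\<forall>\<^sub>F N in sequentially. real (q ^ l) / real N < \<epsilon> / 2"
    using \<open>\<epsilon> > 0\<close> by (intro order_tendstoD(2)) auto
  then show "\<forall>\<^sub>F N in sequentially. dist ((\<Sum>n<N. f (p * n) * cnj (f (p' * n))) / of_nat N) 0 < \<epsilon>"
    using eventually_gt_at_top[of 0]
  proof eventually_elim
    case (elim N)
    then have "cmod ((\<Sum>n<N. f (p * n) * cnj (f (p' * n))) / of_nat N) < \<epsilon>"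
      using average_norm_le[OF elim(2), of p p' l] l by linarith
    then show ?case by (simp only: dist_norm diff_zero)
  qed
qed

lemma almost_periodic_or_corr_sup_tendsto_0:
  assumes p: "1 < p" "p < p'" and coprime: "coprime p p'" "coprime p q" "coprime p' q"
  shows "almost_periodic f \<or> corr_sup p p' \<longlonglongrightarrow> 0"
proof (rule disjCI)
  assume not_0: "\<not> corr_sup p p' \<longlonglongrightarrow> 0"
  define a where "a = corr_sup p p'"
  have "decseq a" unfolding decseq_Suc_iff a_def using corr_sup_add_le[where T = 1] by simp
  moreover have a_nonneg: "0 \<le> a l" for l by (simp add: a_def corr_sup_nonneg)
  ultimately obtain \<alpha> where \<alpha>: "a \<longlonglongrightarrow> \<alpha>" and a_ge: "\<And>l. \<alpha> \<le> a l"
    using decseq_convergent[of a 0] by blast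
  have "\<alpha> \<ge> 0" using \<alpha> a_nonneg by (intro LIMSEQ_le_const) auto
  with \<alpha> not_0 have "\<alpha> > 0" by (cases "\<alpha> = 0") (auto simp: a_def)
  obtain C v where Cv: "\<And>h \<omega>. semimultiplicative q h \<Longrightarrow> shift_invariant q v p p' \<omega> h \<Longrightarrow>
      \<exists>\<zeta>. \<zeta> ^ (p' - p) = 1 \<and> (\<forall>n<q ^ 3. cmod (h (q * n) - \<zeta> ^ n) \<le> C * \<omega>)"
    using local_rigidity[OF p coprime q_ge_2] by blast
  define u where "u = 2 * p * p'"
  have u: "2 * p * p' \<le> q ^ u"
  proof -
    have "u < 2 ^ u" by (rule less_exp)
    also have "\<dots> \<le> q ^ u" using q_ge_2 by (intro power_mono) auto
    finally show ?thesis by (simp add: u_def)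
  qed
  define T where "T = u + v"
  \<comment> \<open>The differences telescope and \<open>(1 / 2) ^ l\<close> is a summable choice of
    the slack \<open>t\<close>. Thus \<open>\<gamma>\<close> is summable and its square root
    \<open>\<eta>\<close> is square-summable, as the criterion for almost periodicity asks.\<close>
  define \<gamma> where "\<gamma> l = 2 * real (q ^ T) * (a l - a (l + T) + (1 / 2) ^ l)" for l
  have \<gamma>_summable: "summable \<gamma>"
    unfolding \<gamma>_def using \<alpha>
    by (intro summable_mult summable_add summable_diff_shift summable_geometric) (auto simp: convergent_def)
  have \<gamma>_nonneg: "0 \<le> \<gamma> l" for l
    unfolding \<gamma>_def a_def using corr_sup_add_le[of p p' l T] by (intro mult_nonneg_nonneg add_nonneg_nonneg) auto
  define \<eta> where "\<eta> l = sqrt (\<gamma> l)" for l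
  have "\<eta> \<longlonglongrightarrow> 0"
    unfolding \<eta>_def using tendsto_real_sqrt[OF summable_LIMSEQ_zero[OF \<gamma>_summable]] by simp
  then have "\<forall>\<^sub>F l in sequentially. \<eta> l < \<alpha> / 4"
    using \<open>\<alpha> > 0\<close> by (intro order_tendstoD(2)) auto
  moreover have "(\<lambda>l. (1 / 2 :: real) ^ l) \<longlonglongrightarrow> 0" by (rule LIMSEQ_realpow_zero) auto
  then have "\<forall>\<^sub>F l in sequentially. (1 / 2 :: real) ^ l < \<alpha> / 4"
    using \<open>\<alpha> > 0\<close> by (intro order_tendstoD(2)) auto
  ultimately have "\<forall>\<^sub>F l in sequentially. \<eta> l < \<alpha> / 4 \<and> (1 / 2 :: real) ^ l < \<alpha> / 4"
    by (rule eventually_conj)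
  then obtain L where L: "\<And>l. l \<ge> L \<Longrightarrow> \<eta> l < \<alpha> / 4 \<and> (1 / 2 :: real) ^ l < \<alpha> / 4"
    by (auto simp: eventually_sequentially)
  \<comment> \<open>Of \<open>\<alpha>\<close>, one quarter is lost to the slack and one to
    \<open>\<eta> l\<close>, which leaves the lower bound
    \<open>\<beta> = \<alpha> / 2\<close>.\<close>
  define \<omega> where "\<omega> l = 2 * \<eta> l / (\<alpha> / 2)" for l
  have char: "\<exists>\<zeta>. \<zeta> ^ (p' - p) = 1 \<and>
      (\<forall>n<q ^ 3. cmod (f (q ^ (l + Suc u) * n) - \<zeta> ^ n) \<le> C * \<omega> l)" if "l \<ge> L" for l
  proof -
    obtain x x' B where B: "cmod B \<ge> a (l + T) - (1 / 2) ^ l"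
      and const: "\<And>D. D < q ^ T \<Longrightarrow>
        (cmod (corr p p' l (q ^ T * x + p * D) (q ^ T * x' + p' * D) - B))\<^sup>2 \<le> \<gamma> l"
      using corr_nearly_constant[of "(1 / 2) ^ l" p p' l T] unfolding \<gamma>_def a_def by auto
    have "\<alpha> / 2 \<le> cmod B - \<eta> l" using B a_ge[of "l + T"] L[OF that] by linarith
    then have "shift_invariant q v p p' (\<omega> l) (\<lambda>n. f (q ^ (l + u) * n))"
      unfolding \<omega>_def using const \<open>\<alpha> > 0\<close>
      by (intro shift_invariant_if_corr_nearly_constant[OF u, where B = B and x = x and x' = x'])
         (auto simp: T_def \<eta>_def intro!: real_le_rsqrt)
    from Cv[OF dilate this] show ?thesis by (simp add: mult_ac)
  qed
  \<comment> \<open>The default \<open>1\<close> is a root of unity of every order, so the root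
    condition holds at all levels.\<close>
  define \<zeta> where "\<zeta> l = (if L + Suc u \<le> l then SOME z. z ^ (p' - p) = 1 \<and>
      (\<forall>n<q ^ 3. cmod (f (q ^ l * n) - z ^ n) \<le> C * \<omega> (l - Suc u)) else 1)" for l
  have \<zeta>: "\<zeta> l ^ (p' - p) = 1 \<and> (\<forall>n<q ^ 3. cmod (f (q ^ l * n) - \<zeta> l ^ n) \<le> C * \<omega> (l - Suc u))"
    if "L + Suc u \<le> l" for l
  proof -
    have "l - Suc u \<ge> L" "l - Suc u + Suc u = l" using that by auto
    from someI_ex[OF char[OF this(1), unfolded this(2)]] show ?thesis
      using that by (simp add: \<zeta>_def)
  qed
  show "almost_periodic f"
  proof (rule almost_periodic_if_close_to_characters)
    show "0 < p' - p" using p by simp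
    show "\<zeta> l ^ (p' - p) = 1" for l
      using \<zeta>[of l] by (cases "L + Suc u \<le> l") (auto simp: \<zeta>_def)
    show "cmod (f (q ^ l * n) - \<zeta> l ^ n) \<le> C * \<omega> (l - Suc u)" if "L + Suc u \<le> l" "n < q ^ 3" for l n
      using \<zeta> that by blast
    have "(C * \<omega> l)\<^sup>2 = (C * 4 / \<alpha>)\<^sup>2 * \<gamma> l" for l
      using \<gamma>_nonneg[of l] by (simp add: \<omega>_def \<eta>_def power_mult_distrib power_divide)
    then have "summable (\<lambda>l. (C * \<omega> l)\<^sup>2)"
      using \<gamma>_summable by (simp add: summable_mult)
    then show "summable (\<lambda>l. (C * \<omega> (l - Suc u))\<^sup>2)"
      using summable_iff_shift[of "\<lambda>l. (C * \<omega> (l - Suc u))\<^sup>2" "Suc u"] by simp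
  qed
qed

end

section \<open>Reduction to separation by a single digit, and the theorem\<close>

text \<open>
  Grouping the base-\<open>q\<close> digits into blocks of length at least \<open>r\<close> turns a sequence with windows
  of length \<open>r\<close> into one with windows of length \<open>1\<close>.
\<close>

lemma semimultiplicative_block_base:
  assumes q: "q \<ge> 2" and f: "q_semimultiplicative q f"
  obtains s where "semimultiplicative (q ^ s) f"
proof -
  from f obtain r where norm: "range f \<subseteq> sphere 0 1" and f0: "f 0 = 1"
    and rule: "\<And>n m k l. k < q ^ l \<Longrightarrow> q ^ l dvd m \<Longrightarrow> m < q ^ (l + r) \<Longrightarrow> q ^ (l + r) dvd n \<Longrightarrow>
      f (n + m + k) = f (n + m) * f (m + k) / f m"
    unfolding q_semimultiplicative_def by blast
  \<comment> \<open>With \<open>Suc r\<close> the new base is at least \<open>2\<close> even when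
    \<open>r = 0\<close>.\<close>
  define s where "s = Suc r"
  have norm: "cmod (f n) = 1" for n
  proof -
    have "f n \<in> sphere 0 1" using norm by blast
    then show ?thesis by simp
  qed
  then have nonzero: "f n \<noteq> 0" for n by (metis norm_zero zero_neq_one)
  have "semimultiplicative (q ^ s) f"
  proof
    have "2 ^ 1 \<le> q ^ s"
      using q by (intro order_trans[OF power_mono[of 2 q 1] power_increasing]) (auto simp: s_def)
    then show "q ^ s \<ge> 2" by simp
  next
    fix k l y assume k: "k < (q ^ s) ^ l"
    define Q where "Q = (q ^ s) ^ l"
    define m where "m = y mod q ^ s"
    define n where "n = q ^ s * (y div q ^ s)"
    have y: "y = n + m" by (simp add: n_def m_def)
    \<comment> \<open>The lowest \<open>r\<close> base-\<open>q\<close> digits of the block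
      \<open>m\<close> form the separating window. Cutting there in \<open>y\<close> and in
      \<open>m\<close> yields the same factor \<open>f (Q * b + k) / f (Q * b)\<close>.\<close>
    define b where "b = m mod q ^ r"
    define c where "c = q ^ r * (m div q ^ r)"
    have m: "m = c + b" by (simp add: b_def c_def)
    have Q: "Q = q ^ (s * l)" by (simp add: Q_def power_mult)
    have b: "b < q ^ r" using q by (simp add: b_def)
    have split: "f (Q * t + Q * b + k) = f (Q * t + Q * b) * f (Q * b + k) / f (Q * b)" if "q ^ r dvd t" for t
    proof (rule rule)
      show "k < q ^ (s * l)" using k by (simp add: Q_def flip: Q)
      show "q ^ (s * l) dvd Q * b" by (simp add: Q)
      show "Q * b < q ^ (s * l + r)" using b q by (simp add: Q power_add)
      show "q ^ (s * l + r) dvd Q * t" using that by (simp add: Q power_add mult_dvd_mono)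
    qed
    have "q ^ r dvd c" by (simp add: c_def)
    moreover have "q ^ r dvd n + c" by (simp add: n_def c_def s_def dvd_add mult.assoc dvd_mult)
    ultimately have "f (Q * (n + c) + Q * b + k) = f (Q * (n + c) + Q * b) * f (Q * b + k) / f (Q * b)"
      "f (Q * c + Q * b + k) = f (Q * c + Q * b) * f (Q * b + k) / f (Q * b)"
      using split by blast+
    then have "f (Q * y + k) = f (Q * y) * f (Q * b + k) / f (Q * b)"
      "f (Q * m + k) = f (Q * m) * f (Q * b + k) / f (Q * b)"
      by (simp_all add: y m algebra_simps)
    then show "f ((q ^ s) ^ l * y + k) =
        f ((q ^ s) ^ l * y) * f ((q ^ s) ^ l * (y mod q ^ s) + k) / f ((q ^ s) ^ l * (y mod q ^ s))"
      using nonzero by (simp flip: Q_def m_def)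
  qed (use norm f0 in auto)
  then show ?thesis using that by blast
qed

theorem theoremB:
  fixes q :: nat and f :: "nat \<Rightarrow> complex"
  assumes "q \<ge> 2"
    and "q_semimultiplicative q f"
  shows "almost_periodic f \<or>
    (\<exists>P::nat. \<forall>p p'. prime p \<and> prime p' \<and> p \<noteq> p' \<and> p \<ge> P \<and> p' \<ge> P \<longrightarrow>
       (\<lambda>N. (\<Sum>n<N. f (p * n) * cnj (f (p' * n))) / of_nat N) \<longlonglongrightarrow> 0)"
proof (cases "almost_periodic f")
  case False
  obtain s where "semimultiplicative (q ^ s) f"
    using semimultiplicative_block_base[OF assms] .
  then interpret semimultiplicative "q ^ s" f .
  \<comment> \<open>Primes above \<open>q\<close> do not divide it and are coprime to every power of
    \<open>q\<close>, so \<open>P = Suc q\<close> is a valid threshold.\<close>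
  have less: "(\<lambda>N. (\<Sum>n<N. f (p * n) * cnj (f (p' * n))) / of_nat N) \<longlonglongrightarrow> 0"
    if p: "prime p" "prime p'" "Suc q \<le> p" "p < p'" for p p'
  proof -
    have "coprime p q" "coprime p' q"
      using p assms(1) by (auto intro!: prime_imp_coprime dest: dvd_imp_le)
    moreover have "coprime p p'" using p by (simp add: primes_coprime)
    ultimately have "corr_sup p p' \<longlonglongrightarrow> 0"
      using almost_periodic_or_corr_sup_tendsto_0[of p p'] p False prime_gt_1_nat by auto
    then show ?thesis by (rule average_tendsto_0)
  qed
  have "(\<lambda>N. (\<Sum>n<N. f (p * n) * cnj (f (p' * n))) / of_nat N) \<longlonglongrightarrow> 0"
    if p: "prime p" "prime p'" "p \<noteq> p'" "Suc q \<le> p" "Suc q \<le> p'" for p p'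
  proof (cases "p < p'")
    case True
    then show ?thesis using less p by blast
  next
    case False
    then have "(\<lambda>N. (\<Sum>n<N. f (p' * n) * cnj (f (p * n))) / of_nat N) \<longlonglongrightarrow> 0"
      using less[of p' p] p by simp
    from tendsto_cnj[OF this] show ?thesis by (simp add: mult.commute)
  qed
  then show ?thesis by blast
qed simp

end
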